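(* Let $N\ge 2$ be an integer and $1<p\le N$, and let $\beta_*=\beta_*(N,p)>0$ be the spherical $p$-harmonic exponent of the half-space defined in the context. (i) If $2\le p\le N$, then $\beta_*\le \frac{N-1}{p-1}$, with equality only if $p=2$ or $p=N$. (ii) If $1<p<2$, then $\beta_*>\frac{N-1}{p-1}$.
   Context: Let $\mathbb{R}^N_+=\{x=(x',x_N):x'\in\mathbb{R}^{N-1},x_N>0\}$, let $S^{N-1}$ be the unit sphere of $\mathbb{R}^N$ and $S^{N-1}_+=S^{N-1}\cap\mathbb{R}^N_+$ the open upper hemisphere. $\nabla'$ and $\mathrm{div}'$ denote the tangential gradient and the divergence on $S^{N-1}$. The exponent $\beta_*$ is the unique positive real number such that there exists a function $\psi\in C^2(\overline{S^{N-1}_+})$, $\psi>0$ in $S^{N-1}_+$, with $$-\mathrm{div}'\left((\beta_*^2\psi^2+|\nabla'\psi|^2)^{\frac{p-2}{2}}\nabla'\psi\right)-\beta_*\Lambda_{\beta_*}(\beta_*^2\psi^2+|\nabla'\psi|^2)^{\frac{p-2}{2}}\psi=0\ \text{ in }S^{N-1}_+,\qquad \psi=0\ \text{ on }\partial S^{N-1}_+,$$ where $\Lambda_{\beta_*}=\beta_*(p-1)+p-N$. Equivalently, $x\mapsto |x|^{-\beta_*}\psi(x/|x|)$ is a positive $p$-harmonic function in $\mathbb{R}^N_+$ vanishing on $\partial\mathbb{R}^N_+\setminus\{0\}$. It is known that such a $\beta_*>0$ exists and is unique, and that $\psi$ is unique up to multiplication by a positive constant. *)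

theory Defs
  imports "HOL-Analysis.Analysis"
begin

text \<open>
  The space \<open>'a::euclidean_space\<close> plays the role of \<open>R^N\<close>, \<open>N = DIM('a)\<close>. The basis vector \<open>e\<close> is the
  direction of the last coordinate, \<open>x_N = x \<bullet> e\<close>.
\<close>

definition upper_hemisphere :: "'a::euclidean_space \<Rightarrow> 'a set" where
  "upper_hemisphere e = {\<sigma> \<in> sphere 0 1. 0 < \<sigma> \<bullet> e}"

definition closed_hemisphere :: "'a::euclidean_space \<Rightarrow> 'a set" where
  "closed_hemisphere e = {\<sigma> \<in> sphere 0 1. 0 \<le> \<sigma> \<bullet> e}"

definition equator :: "'a::euclidean_space \<Rightarrow> 'a set" where
  "equator e = {\<sigma> \<in> sphere 0 1. \<sigma> \<bullet> e = 0}"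

definition tangent_proj :: "'a::euclidean_space \<Rightarrow> 'a \<Rightarrow> 'a" where
  "tangent_proj \<sigma> v = v - (v \<bullet> \<sigma>) *\<^sub>R \<sigma>"

text \<open>
  A derivative relative to the sphere is determined only on vectors tangent at \<open>\<sigma>\<close>. Precomposing
  with \<open>tangent_proj \<sigma>\<close> removes the dependence on the choice made by \<^const>\<open>frechet_derivative\<close>.
  Thus \<open>tgrad f \<sigma>\<close> is the tangent vector representing the differential of \<open>f\<close> on the tangent space
  at \<open>\<sigma>\<close> (the Riemannian gradient for the induced metric). For a tangential field \<open>X\<close>, the number
  \<open>tdiv X \<sigma>\<close> is the trace of the endomorphism \<open>v \<mapsto> tangent_proj \<sigma> (D X v)\<close> of the tangent space,
  which is the covariant derivative of \<open>X\<close>, so it is the Riemannian divergence.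
\<close>

definition tgrad :: "('a::euclidean_space \<Rightarrow> real) \<Rightarrow> 'a \<Rightarrow> 'a" where
  "tgrad f \<sigma> =
     (\<Sum>b\<in>Basis. frechet_derivative f (at \<sigma> within sphere 0 1) (tangent_proj \<sigma> b) *\<^sub>R b)"

definition tdiv :: "('a::euclidean_space \<Rightarrow> 'a) \<Rightarrow> 'a \<Rightarrow> real" where
  "tdiv X \<sigma> =
     (\<Sum>b\<in>Basis. frechet_derivative X (at \<sigma> within sphere 0 1) (tangent_proj \<sigma> b) \<bullet> b)"

definition C2_on_open :: "'a::euclidean_space set \<Rightarrow> ('a \<Rightarrow> real) \<Rightarrow> bool" where
  "C2_on_open U g \<longleftrightarrow> open U \<and>
     (\<exists>(G :: 'a \<Rightarrow> 'a) (H :: 'a \<Rightarrow> ('a \<Rightarrow>\<^sub>L 'a)).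
        (\<forall>x\<in>U. (g has_derivative (\<lambda>h. G x \<bullet> h)) (at x)) \<and>
        (\<forall>x\<in>U. (G has_derivative blinfun_apply (H x)) (at x)) \<and>
        continuous_on U H)"

text \<open>
  As usual for a compact submanifold with boundary, \<open>C\<^sup>2\<close> up to the boundary means being the
  restriction of a \<open>C\<^sup>2\<close> function defined on an open neighbourhood in the ambient space.
\<close>

definition C2_on_closed_hemisphere :: "'a::euclidean_space \<Rightarrow> ('a \<Rightarrow> real) \<Rightarrow> bool" where
  "C2_on_closed_hemisphere e \<psi> \<longleftrightarrow>
     (\<exists>U g. closed_hemisphere e \<subseteq> U \<and> C2_on_open U g \<and> (\<forall>\<sigma>\<in>closed_hemisphere e. g \<sigma> = \<psi> \<sigma>))"

definition p_weight :: "real \<Rightarrow> real \<Rightarrow> ('a::euclidean_space \<Rightarrow> real) \<Rightarrow> 'a \<Rightarrow> real" where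
  "p_weight p \<beta> \<psi> \<sigma> = (\<beta>\<^sup>2 * (\<psi> \<sigma>)\<^sup>2 + (norm (tgrad \<psi> \<sigma>))\<^sup>2) powr ((p - 2) / 2)"

definition Lambda :: "'a::euclidean_space itself \<Rightarrow> real \<Rightarrow> real \<Rightarrow> real" where
  "Lambda T p \<beta> = \<beta> * (p - 1) + p - real DIM('a)"

text \<open>
  The left-hand side of the equation below is differentiated only at points of the open hemisphere,
  where \<open>\<psi> > 0\<close>; there the base of \<^const>\<open>powr\<close> is positive and the field under the divergence is \<open>C\<^sup>1\<close>.
\<close>

definition spherical_p_harmonic ::
    "'a::euclidean_space \<Rightarrow> real \<Rightarrow> real \<Rightarrow> ('a \<Rightarrow> real) \<Rightarrow> bool" where
  "spherical_p_harmonic e p \<beta> \<psi> \<longleftrightarrow>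
     C2_on_closed_hemisphere e \<psi> \<and>
     (\<forall>\<sigma>\<in>upper_hemisphere e. \<psi> \<sigma> > 0) \<and>
     (\<forall>\<sigma>\<in>upper_hemisphere e.
        - tdiv (\<lambda>y. p_weight p \<beta> \<psi> y *\<^sub>R tgrad \<psi> y) \<sigma>
        - \<beta> * Lambda TYPE('a) p \<beta> * p_weight p \<beta> \<psi> \<sigma> * \<psi> \<sigma> = 0) \<and>
     (\<forall>\<sigma>\<in>equator e. \<psi> \<sigma> = 0)"

text \<open>
  The defining property of the exponent \<open>\<beta>\<^sub>*\<close>. Exactly one real number is known to have it, but
  this fact is not built into the definition.
\<close>

definition is_spherical_exponent :: "'a::euclidean_space \<Rightarrow> real \<Rightarrow> real \<Rightarrow> bool" where
  "is_spherical_exponent e p \<beta> \<longleftrightarrow> \<beta> > 0 \<and> (\<exists>\<psi>. spherical_p_harmonic e p \<beta> \<psi>)"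

end

theory Submission
  imports Defs
begin

text \<open>
  The function \<open>m = ln \<psi> / \<beta>\<close> satisfies \<open>E(m) = 0\<close> in the open hemisphere, where
  \<open>E(m) = (1 + |\<nabla>' m|\<^sup>2) (\<Delta>' m + (p - 1) \<beta> (1 + |\<nabla>' m|\<^sup>2) + p - N) + (p - 2) D\<^sup>2 m (\<nabla>' m, \<nabla>' m)\<close>
  is elliptic and increasing in \<open>\<beta>\<close>. For \<open>\<beta> = (N - 1) / (p - 1)\<close> and \<open>m = ln (\<sigma> \<bullet> e) / \<beta>\<close> one finds
  that \<open>E(m)\<close> has the sign of \<open>p - 2\<close> if \<open>p < N\<close>. A small perturbation of this function gives a strict
  sub- or supersolution \<open>h\<close>.

  If \<open>p \<ge> 2\<close> and the assertion fails, choose \<open>h\<close> with \<open>E(h) > 0\<close> tending to \<open>-\<infinity>\<close> at the boundary of a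
  slightly smaller cap, on which \<open>m\<close> is bounded below: \<open>m - h\<close> has an interior minimum. If \<open>p < 2\<close> and
  the assertion fails, choose \<open>h\<close> with \<open>E(h) < 0\<close> finite on the closed hemisphere: \<open>m - h\<close> tends to
  \<open>-\<infinity>\<close> at the equator and has an interior maximum. At the contact point gradients agree and
  Hessians are ordered, which contradicts \<open>E(m) = 0\<close>. No Hopf lemma or strong maximum principle is
  needed, and \<open>\<psi>\<close> need not depend on the height alone.
\<close>

subsection \<open>Barriers depending on the height\<close>

text \<open>
  The expression \<open>E(h)\<close> for a function \<open>h\<close> of the height \<open>t = \<sigma> \<bullet> e\<close>, with \<open>y = h'(t)\<close> and
  \<open>y' = h''(t)\<close>; here \<open>|\<nabla>' h|\<^sup>2 = y\<^sup>2 (1 - t\<^sup>2)\<close>.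
\<close>

definition barrier_operator :: "real \<Rightarrow> real \<Rightarrow> real \<Rightarrow> real \<Rightarrow> real \<Rightarrow> real \<Rightarrow> real" where
  "barrier_operator n p b t y y' =
     (1 + y\<^sup>2 * (1 - t\<^sup>2)) * (y' * (1 - t\<^sup>2) - (n - 1) * t * y + (p - 1) * b * (1 + y\<^sup>2 * (1 - t\<^sup>2)) + p - n) +
     (p - 2) * y\<^sup>2 * (1 - t\<^sup>2) * (y' * (1 - t\<^sup>2) - t * y)"

text \<open>
  This is \<open>b\<^sup>3 (t - \<tau>)\<^sup>4 E(h)\<close> for \<open>b h(t) = (1 + \<kappa>) ln (t - \<tau>) - 2 \<kappa> t\<close>. The base case
  \<open>\<kappa> = \<tau> = 0\<close> is the function \<open>|x| powr (- b) * (x \<bullet> e) / |x|\<close>. There the polynomial may vanish at the equator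
  \<open>t = 0\<close> and at the pole \<open>t = 1\<close>, and the profile \<open>ln t - 2 t\<close> has been chosen so that its first
  variation in \<open>\<kappa>\<close> is positive at both. The shift \<open>\<tau>\<close> makes the comparison at the boundary trivial.
\<close>

definition barrier_poly :: "real \<Rightarrow> real \<Rightarrow> real \<Rightarrow> real \<Rightarrow> real \<Rightarrow> real \<Rightarrow> real" where
  "barrier_poly n p b \<kappa> \<tau> t =
     (b\<^sup>2 * (t - \<tau>)\<^sup>2 + (1 + \<kappa> - 2 * \<kappa> * (t - \<tau>))\<^sup>2 * (1 - t\<^sup>2)) *
       (- (1 + \<kappa>) * (1 - t\<^sup>2) - (n - 1) * t * (1 + \<kappa> - 2 * \<kappa> * (t - \<tau>)) * (t - \<tau>)
        + (p - 1) * (b\<^sup>2 * (t - \<tau>)\<^sup>2 + (1 + \<kappa> - 2 * \<kappa> * (t - \<tau>))\<^sup>2 * (1 - t\<^sup>2))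
        + (p - n) * b * (t - \<tau>)\<^sup>2) +
     (p - 2) * (1 + \<kappa> - 2 * \<kappa> * (t - \<tau>))\<^sup>2 * (1 - t\<^sup>2) *
       (- (1 + \<kappa>) * (1 - t\<^sup>2) - t * (1 + \<kappa> - 2 * \<kappa> * (t - \<tau>)) * (t - \<tau>))"

text \<open>The gradient factor \<open>1 + y^2 (1 - t^2)\<close> has denominator
  \<open>b^2 (t - \<tau>)^2\<close> and every bracket containing \<open>y'\<close> has denominator
  \<open>b (t - \<tau>)^2\<close>. Both summands of the operator therefore share the denominator
  \<open>b^3 (t - \<tau>)^4\<close>.\<close>

lemma barrier_operator_eq:
  assumes "b > 0" "t \<noteq> \<tau>"
  shows "barrier_operator n p b t (((1 + \<kappa>) / (t - \<tau>) - 2 * \<kappa>) / b) (- ((1 + \<kappa>) / (t - \<tau>)\<^sup>2) / b)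
    = barrier_poly n p b \<kappa> \<tau> t / (b ^ 3 * (t - \<tau>) ^ 4)"
proof -
  define z where "z = t - \<tau>"
  define s where "s = 1 - t\<^sup>2"
  define A where "A = 1 + \<kappa> - 2 * \<kappa> * z"
  have z: "z \<noteq> 0" using assms z_def by simp
  have y: "((1 + \<kappa>) / z - 2 * \<kappa>) / b = A / (b * z)"
    using z assms by (simp add: A_def field_simps)
  have y': "- ((1 + \<kappa>) / z\<^sup>2) / b = - (1 + \<kappa>) / (b * z\<^sup>2)"
    using z assms by (simp add: field_simps)
  define c where "c = 1 + \<kappa>"
  have bz: "b \<noteq> 0" using assms by simp
  have q: "1 + (A / (b * z))\<^sup>2 * s = (b\<^sup>2 * z\<^sup>2 + A\<^sup>2 * s) / (b\<^sup>2 * z\<^sup>2)"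
    using z bz by (simp add: field_simps)
  define Q where "Q = b\<^sup>2 * z\<^sup>2 + A\<^sup>2 * s"
  have 1: "- c / (b * z\<^sup>2) * s - (n - 1) * t * (A / (b * z)) + (p - 1) * b * (Q / (b\<^sup>2 * z\<^sup>2)) + p - n
      = (- c * s - (n - 1) * t * A * z + (p - 1) * Q + (p - n) * b * z\<^sup>2) / (b * z\<^sup>2)"
    using z bz by (simp add: field_simps power2_eq_square)
  have 2: "- c / (b * z\<^sup>2) * s - t * (A / (b * z)) = (- c * s - t * A * z) / (b * z\<^sup>2)"
    using z bz by (simp add: field_simps power2_eq_square)
  have 3: "(p - 2) * (A / (b * z))\<^sup>2 * s = (p - 2) * A\<^sup>2 * s / (b\<^sup>2 * z\<^sup>2)"
    by (simp add: power_divide power_mult_distrib)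
  have 4: "b ^ 3 * z ^ 4 = (b\<^sup>2 * z\<^sup>2) * (b * z\<^sup>2)"
    by (simp add: power2_eq_square power3_eq_cube power4_eq_xxxx)
  show ?thesis
    unfolding barrier_operator_def barrier_poly_def
    unfolding z_def[symmetric] s_def[symmetric]
    unfolding y y' A_def[symmetric]
    unfolding c_def[symmetric] q Q_def[symmetric] 1 2 3 4 times_divide_times_eq by (rule add_divide_distrib[symmetric])
qed

section \<open>Perturbing inequalities on a compact interval\<close>

text \<open>By compactness \<open>F 0\<close> has a positive minimum on the interval, and uniform
  continuity on the square bounds the change of \<open>F\<close> by this minimum on all nearby
  slices.\<close>

lemma positive_near_slice:
  fixes F :: "real \<Rightarrow> real \<Rightarrow> real"
  assumes cont: "continuous_on ({0..1} \<times> {0..1}) (\<lambda>x. F (fst x) (snd x))"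
    and pos: "\<And>t. t \<in> {0..1} \<Longrightarrow> F 0 t > 0"
  shows "\<exists>d>0. d < 1 \<and> (\<forall>k\<in>{0..d}. \<forall>t\<in>{0..1}. F k t > 0)"
proof -
  have "compact ({0..1} \<times> {0..1} :: (real \<times> real) set)"
    by (intro compact_Times) auto
  from compact_uniformly_continuous[OF cont this]
  have uc: "uniformly_continuous_on ({0..1} \<times> {0..1}) (\<lambda>x. F (fst x) (snd x))" .
  have c0: "continuous_on {0..1} (\<lambda>t. F 0 t)"
    using continuous_on_compose2[OF cont continuous_on_Pair[of "{0..1}" "\<lambda>_. 0" "\<lambda>t. t"]]
    by (auto simp: image_subset_iff)
  obtain t0 where t0: "t0 \<in> {0..1}" "\<And>t. t \<in> {0..1} \<Longrightarrow> F 0 t0 \<le> F 0 t"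
    using continuous_attains_inf[OF compact_Icc _ c0] by (metis atLeastAtMost_iff empty_iff order_refl zero_le_one)
  obtain d where d: "d > 0" and dd: "\<And>x x'. x \<in> {0..1} \<times> {0..1} \<Longrightarrow> x' \<in> {0..1} \<times> {0..1} \<Longrightarrow> dist x' x < d
      \<Longrightarrow> dist (F (fst x') (snd x')) (F (fst x) (snd x)) < F 0 t0"
    using uc pos[OF t0(1)] unfolding uniformly_continuous_on_def by metis
  define d' where "d' = min (d / 2) (1 / 2)"
  have "F k t > 0" if "k \<in> {0..d'}" "t \<in> {0..1}" for k t
  proof -
    have "dist (k, t) (0, t) < d" using that d by (auto simp: dist_Pair_Pair d'_def)
    moreover have "k \<in> {0..1}" using that by (auto simp: d'_def)
    ultimately have "dist (F k t) (F 0 t) < F 0 t0"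
      using dd[of "(0, t)" "(k, t)"] that by auto
    with t0(2)[OF that(2)] show ?thesis by (auto simp: dist_real_def)
  qed
  moreover have "d' > 0" "d' < 1" using d by (auto simp: d'_def)
  ultimately show ?thesis by blast
qed

text \<open>On the compact set where \<open>S 0\<close> is not positive, \<open>f\<close> is bounded
  away from zero, so \<open>M * f + S 0 > 0\<close> on the whole interval for some \<open>M\<close>.
  This persists for \<open>S k\<close> with small \<open>k\<close>. Multiplying by \<open>k\<close>
  and using \<open>k * M \<le> 1\<close> replaces \<open>k * M * f\<close> by
  \<open>f\<close>.\<close>

lemma positive_first_order_perturbation:
  fixes f :: "real \<Rightarrow> real" and S :: "real \<Rightarrow> real \<Rightarrow> real"
  assumes f: "continuous_on {0..1} f" "\<And>t. t \<in> {0..1} \<Longrightarrow> f t \<ge> 0"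
    and S: "continuous_on ({0..1} \<times> {0..1}) (\<lambda>x. S (fst x) (snd x))"
    and zero: "\<And>t. t \<in> {0..1} \<Longrightarrow> f t = 0 \<Longrightarrow> S 0 t > 0"
  shows "\<exists>k>0. k < 1 \<and> (\<forall>t\<in>{0..1}. f t + k * S k t > 0)"
proof -
  have c0: "continuous_on {0..1} (\<lambda>t. S 0 t)"
    using continuous_on_compose2[OF S continuous_on_Pair[of "{0..1}" "\<lambda>_. 0" "\<lambda>t. t"]]
    by (auto simp: image_subset_iff)
  define K where "K = {t\<in>{0..1}. S 0 t \<in> {..0}}"
  have "closed K"
    unfolding K_def using continuous_closed_preimage[OF c0 closed_real_atLeastAtMost closed_atMost[of 0]]
    by (simp add: vimage_def Int_def)
  then have K: "compact K"
    unfolding K_def compact_eq_bounded_closed by (auto intro: bounded_subset[OF bounded_closed_interval[of 0 1]])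
  have "\<exists>M>0. \<forall>t\<in>K. M * f t + S 0 t > 0"
  proof (cases "K = {}")
    case True
    then show ?thesis by (intro exI[of _ 1]) auto
  next
    case False
    have KI: "K \<subseteq> {0..1}" by (auto simp: K_def)
    obtain t0 where t0: "t0 \<in> K" "\<And>t. t \<in> K \<Longrightarrow> f t0 \<le> f t"
      using continuous_attains_inf[OF K False continuous_on_subset[OF f(1) KI]] by blast
    obtain t1 where t1: "t1 \<in> K" "\<And>t. t \<in> K \<Longrightarrow> S 0 t1 \<le> S 0 t"
      using continuous_attains_inf[OF K False continuous_on_subset[OF c0 KI]] by blast
    have f0: "f t0 > 0" using f(2)[of t0] zero[of t0] t0(1) by (fastforce simp: K_def)
    have s1: "S 0 t1 \<le> 0" using t1(1) by (auto simp: K_def)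
    \<comment> \<open>With this choice \<open>M * f t0 = 1 - S 0 t1\<close>, so
      \<open>M * f + S 0\<close> is at least 1 on \<open>K\<close>.\<close>
    define M where "M = (1 - S 0 t1) / f t0"
    have M: "M > 0" using f0 s1 by (simp add: M_def)
    have "M * f t + S 0 t > 0" if "t \<in> K" for t
    proof -
      have "1 - S 0 t1 = M * f t0" using f0 by (simp add: M_def)
      also have "\<dots> \<le> M * f t" using M t0(2)[OF that] by simp
      finally show ?thesis using t1(2)[OF that] by linarith
    qed
    with M show ?thesis by blast
  qed
  then obtain M where M: "M > 0" "\<And>t. t \<in> K \<Longrightarrow> M * f t + S 0 t > 0" by blast
  have "M * f t + S 0 t > 0" if "t \<in> {0..1}" for t
  proof (cases "t \<in> K")
    case False
    then have "S 0 t > 0" using that by (auto simp: K_def)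
    then show ?thesis using M(1) f(2)[OF that] by (simp add: add_nonneg_pos)
  qed (rule M)
  moreover have "continuous_on ({0..1} \<times> {0..1}) (\<lambda>x. M * f (snd x) + S (fst x) (snd x))"
    by (intro continuous_intros S continuous_on_compose2[OF f(1)]) auto
  ultimately obtain d where d: "d > 0" "d < 1" "\<And>k t. k \<in> {0..d} \<Longrightarrow> t \<in> {0..1} \<Longrightarrow> M * f t + S k t > 0"
    using positive_near_slice[of "\<lambda>k t. M * f t + S k t"] by blast
  define k where "k = min d (1 / M)"
  have k: "k > 0" "k < 1" "k \<le> d" "k * M \<le> 1"
  proof -
    show "k > 0" "k \<le> d" using d M by (auto simp: k_def)
    then show "k < 1" using d by simp
    have "k \<le> 1 / M" by (simp add: k_def)
    then show "k * M \<le> 1" using M by (simp add: field_simps)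
  qed
  have "f t + k * S k t > 0" if "t \<in> {0..1}" for t
  proof -
    have "0 < k * (M * f t + S k t)" using d(3)[of k t] k that by simp
    also have "\<dots> = (k * M) * f t + k * S k t" by (simp add: algebra_simps)
    also have "\<dots> \<le> f t + k * S k t" using k(4) f(2)[OF that] mult_right_mono[of "k * M" 1 "f t"] by simp
    finally show ?thesis .
  qed
  with k show ?thesis by blast
qed

text \<open>The grouping separates the two effects that decide the sign. The last factor equals
  \<open>(b + 1) * (b * (p - 1) - (n - 1))\<close> and vanishes at the critical exponent
  \<open>b = (n - 1) / (p - 1)\<close>. The first summand in the bracket has the sign of
  \<open>p - 2\<close> when \<open>b > 1\<close> and \<open>0 < t < 1\<close>.\<close>

lemma barrier_poly_0:
  "barrier_poly n p b 0 0 t =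
     t\<^sup>2 * ((p - 2) * (1 - t\<^sup>2) * (b\<^sup>2 - 1) + (b\<^sup>2 * t\<^sup>2 + 1 - t\<^sup>2) * (b * (b * (p - 1) + p - n) - (n - 1)))"
  unfolding barrier_poly_def by (simp add: algebra_simps power2_eq_square)

text \<open>In the proof, \<open>S \<kappa> t\<close> is the difference quotient in \<open>\<kappa>\<close> of the polynomial at \<open>\<tau> = 0\<close>.\<close>

lemma barrier_exists:
  fixes n p b \<epsilon> :: real
  assumes "n > 1" "p > 1" "b > 0" and \<epsilon>: "\<epsilon> = 1 \<or> \<epsilon> = -1"
    and inner: "\<And>t. 0 < t \<Longrightarrow> t < 1 \<Longrightarrow> \<epsilon> * barrier_poly n p b 0 0 t > 0"
    and pole: "\<epsilon> * barrier_poly n p b 0 0 1 \<ge> 0"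
  obtains k \<tau> where "0 < k" "k < 1" "0 < \<tau>" "\<tau> < 1"
    "\<And>t. 0 \<le> t \<Longrightarrow> t \<le> 1 \<Longrightarrow> \<epsilon> * barrier_poly n p b (\<epsilon> * k) (\<epsilon> * \<tau>) t > 0"
proof -
  define q where "q = (\<lambda>\<kappa> t. 2 * (1 - 2 * t) + \<kappa> * (1 - 2 * t)\<^sup>2 :: real)"
  define s where "s = (\<lambda>t. 1 - t\<^sup>2 :: real)"
  define B0 where "B0 = (\<lambda>t. - s t - (n - 1) * t\<^sup>2 + (p - 1) * (b\<^sup>2 * t\<^sup>2 + s t) + (p - n) * b * t\<^sup>2)"
  define B1 where "B1 = (\<lambda>\<kappa> t. - s t - (n - 1) * t\<^sup>2 * (1 - 2 * t) + (p - 1) * q \<kappa> t * s t)"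
  define C1 where "C1 = (\<lambda>t. - s t - t\<^sup>2 * (1 - 2 * t))"
  define S where "S = (\<lambda>\<kappa> t. q \<kappa> t * s t * B0 t + (b\<^sup>2 * t\<^sup>2 + s t) * B1 \<kappa> t + \<kappa> * q \<kappa> t * s t * B1 \<kappa> t
     + (p - 2) * s t * (- q \<kappa> t + C1 t + \<kappa> * q \<kappa> t * C1 t))"
  have P: "barrier_poly n p b \<kappa> 0 t = barrier_poly n p b 0 0 t + \<kappa> * S \<kappa> t" for \<kappa> t
  proof -
    have st: "1 - t\<^sup>2 = s t" by (simp add: s_def)
    have A: "1 + \<kappa> - 2 * \<kappa> * t = 1 + \<kappa> * (1 - 2 * t)" by (simp add: algebra_simps)
    have A2: "(1 + \<kappa> * (1 - 2 * t))\<^sup>2 = 1 + \<kappa> * q \<kappa> t"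
      by (simp add: q_def algebra_simps power2_eq_square)
    have Q: "b\<^sup>2 * t\<^sup>2 + (1 + \<kappa> * q \<kappa> t) * s t = (b\<^sup>2 * t\<^sup>2 + s t) + \<kappa> * q \<kappa> t * s t"
      by (simp add: algebra_simps)
    have B: "- (1 + \<kappa>) * s t - (n - 1) * t * (1 + \<kappa> * (1 - 2 * t)) * t
        + (p - 1) * ((b\<^sup>2 * t\<^sup>2 + s t) + \<kappa> * q \<kappa> t * s t) + (p - n) * b * t\<^sup>2 = B0 t + \<kappa> * B1 \<kappa> t"
      unfolding B0_def B1_def by (simp add: algebra_simps power2_eq_square)
    have C: "- (1 + \<kappa>) * s t - t * (1 + \<kappa> * (1 - 2 * t)) * t = - 1 + \<kappa> * C1 t"
      unfolding C1_def s_def by (simp add: algebra_simps power2_eq_square)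
    have 1: "barrier_poly n p b \<kappa> 0 t = ((b\<^sup>2 * t\<^sup>2 + s t) + \<kappa> * q \<kappa> t * s t) * (B0 t + \<kappa> * B1 \<kappa> t)
        + (p - 2) * (1 + \<kappa> * q \<kappa> t) * s t * (- 1 + \<kappa> * C1 t)"
      unfolding barrier_poly_def diff_zero st A A2 Q B C ..
    have 0: "barrier_poly n p b 0 0 t = (b\<^sup>2 * t\<^sup>2 + s t) * B0 t + (p - 2) * s t * (- 1)"
      unfolding barrier_poly_def B0_def s_def by (simp add: algebra_simps power2_eq_square)
    show ?thesis unfolding 1 0 S_def by (simp add: algebra_simps)
  qed
  \<comment> \<open>Taking \<kappa> = \<open>\<epsilon> * k\<close> makes
    \<open>\<epsilon> * \<kappa> = k\<close>, so the perturbation enters as \<open>+ k * S\<close>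
    for either sign.\<close>
  have "\<exists>k>0. k < 1 \<and> (\<forall>t\<in>{0..1}. \<epsilon> * barrier_poly n p b 0 0 t + k * S (\<epsilon> * k) t > 0)"
  proof (rule positive_first_order_perturbation[of _ "\<lambda>k t. S (\<epsilon> * k) t"])
    show "continuous_on {0..1} (\<lambda>t. \<epsilon> * barrier_poly n p b 0 0 t)"
      unfolding barrier_poly_0 by (intro continuous_intros)
    show "continuous_on ({0..1} \<times> {0..1}) (\<lambda>x. S (\<epsilon> * fst x) (snd x))"
      unfolding S_def q_def s_def B0_def B1_def C1_def by (intro continuous_intros)
    show "\<epsilon> * barrier_poly n p b 0 0 t \<ge> 0" if "t \<in> {0..1}" for t
      using that inner[of t] pole by (cases "t = 0"; cases "t = 1") (auto simp: barrier_poly_0)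
    \<comment> \<open>Zeros occur at most at the equator and at the pole, where
      \<open>S 0 0 = p - 1\<close> and \<open>S 0 1 = b^2 * (n - 1)\<close>.\<close>
    show "S (\<epsilon> * 0) t > 0" if "t \<in> {0..1}" "\<epsilon> * barrier_poly n p b 0 0 t = 0" for t
    proof -
      have "t = 0 \<or> t = 1" using that inner[of t] by fastforce
      then show ?thesis
        using assms by (auto simp: S_def q_def s_def B0_def B1_def C1_def algebra_simps)
    qed
  qed
  then obtain k where k: "k > 0" "k < 1"
    and kpos: "\<And>t. t \<in> {0..1} \<Longrightarrow> \<epsilon> * barrier_poly n p b 0 0 t + k * S (\<epsilon> * k) t > 0" by blast
  have kk: "\<epsilon> * barrier_poly n p b (\<epsilon> * k) 0 t = \<epsilon> * barrier_poly n p b 0 0 t + k * S (\<epsilon> * k) t" for t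
    unfolding P[of "\<epsilon> * k"] using \<epsilon> by (auto simp: algebra_simps)
  \<comment> \<open>With \<kappa> fixed the polynomial is strictly signed on the closed interval, so
    a small shift in either direction is harmless. For \<epsilon> = 1 the singularity moves into the
    hemisphere, for \<epsilon> = -1 it moves below the equator.\<close>
  have "\<exists>d>0. d < 1 \<and> (\<forall>\<tau>\<in>{0..d}. \<forall>t\<in>{0..1}. \<epsilon> * barrier_poly n p b (\<epsilon> * k) (\<epsilon> * \<tau>) t > 0)"
  proof (rule positive_near_slice)
    show "continuous_on ({0..1} \<times> {0..1}) (\<lambda>x. \<epsilon> * barrier_poly n p b (\<epsilon> * k) (\<epsilon> * fst x) (snd x))"
      unfolding barrier_poly_def by (intro continuous_intros)
  qed (use kpos kk in auto)
  then obtain \<tau> where "\<tau> > 0" "\<tau> < 1" "\<forall>t\<in>{0..1}. \<epsilon> * barrier_poly n p b (\<epsilon> * k) (\<epsilon> * \<tau>) t > 0"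
    by (metis atLeastAtMost_iff less_eq_real_def)
  with k that show thesis by auto
qed

subsection \<open>Differential calculus on the sphere\<close>

lemma great_circle_derivative:
  fixes \<sigma> v :: "'a::euclidean_space"
  shows "((\<lambda>r. cos r *\<^sub>R \<sigma> + sin r *\<^sub>R v) has_vector_derivative (cos r *\<^sub>R v - sin r *\<^sub>R \<sigma>)) (at r)"
  by (auto intro!: derivative_eq_intros simp: has_vector_derivative_def algebra_simps)

lemma great_circle_in_sphere:
  fixes \<sigma> v :: "'a::euclidean_space"
  assumes "norm \<sigma> = 1" "norm v = 1" "v \<bullet> \<sigma> = 0"
  shows "cos r *\<^sub>R \<sigma> + sin r *\<^sub>R v \<in> sphere 0 1"
proof -
  have "\<sigma> \<bullet> \<sigma> = 1" "v \<bullet> v = 1" "\<sigma> \<bullet> v = 0" using assms by (auto simp: norm_eq_1 inner_commute)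
  then have "norm (cos r *\<^sub>R \<sigma> + sin r *\<^sub>R v) = 1"
    using assms(3) sin_cos_squared_add2[of r]
    by (simp add: norm_eq_1 inner_add)
  then show ?thesis by simp
qed

text \<open>The great circle through \<sigma> in the direction of \<open>v\<close> stays in the
  sphere. Composition with it turns both relative derivatives into ordinary derivatives of one
  function of a real variable, and these are unique.\<close>

lemma sphere_derivative_unique:
  fixes f :: "'a::euclidean_space \<Rightarrow> 'b::real_normed_vector"
  assumes D: "(f has_derivative D) (at \<sigma> within sphere 0 1)"
    and D': "(f has_derivative D') (at \<sigma> within sphere 0 1)"
    and \<sigma>: "norm \<sigma> = 1" and v: "v \<bullet> \<sigma> = 0"
  shows "D v = D' v"
proof (cases "v = 0")
  case True
  then show ?thesis
    using D D' by (simp add: has_derivative_def bounded_linear.linear linear_0)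
next
  case False
  define u where "u = v /\<^sub>R norm v"
  have u: "norm u = 1" "u \<bullet> \<sigma> = 0" using False v by (auto simp: u_def)
  let ?c = "\<lambda>r. cos r *\<^sub>R \<sigma> + sin r *\<^sub>R u"
  have c: "(?c has_derivative (\<lambda>r. r *\<^sub>R u)) (at 0)"
    using great_circle_derivative[of \<sigma> u 0] by (simp add: has_vector_derivative_def)
  have "((\<lambda>r. f (?c r)) has_derivative (\<lambda>r. E (r *\<^sub>R u))) (at 0)"
    if "(f has_derivative E) (at \<sigma> within sphere 0 1)" for E
  proof (rule has_derivative_in_compose[OF c])
    have "range ?c \<subseteq> sphere 0 1" using great_circle_in_sphere[OF \<sigma> u] by blast
    from has_derivative_subset[OF that this]
    show "(f has_derivative E) (at (?c 0) within range ?c)" by simp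
  qed
  from has_derivative_unique[OF this[OF D] this[OF D']]
  have "D (1 *\<^sub>R u) = D' (1 *\<^sub>R u)" by (rule fun_cong)
  then have "D u = D' u" by simp
  moreover have "v = norm v *\<^sub>R u" using False by (simp add: u_def)
  ultimately show ?thesis
    using D D' by (metis has_derivative_linear linear_scale)
qed

lemma tangent_proj_orthogonal: "norm \<sigma> = 1 \<Longrightarrow> tangent_proj \<sigma> v \<bullet> \<sigma> = 0"
  by (simp add: tangent_proj_def inner_diff_left dot_square_norm)

lemma tangent_proj_fixes: "v \<bullet> \<sigma> = 0 \<Longrightarrow> tangent_proj \<sigma> v = v"
  by (simp add: tangent_proj_def)

lemma tangent_proj_selfadjoint: "tangent_proj \<sigma> v \<bullet> w = v \<bullet> tangent_proj \<sigma> w"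
  by (simp add: tangent_proj_def inner_diff inner_commute)

lemma linear_tangent_proj: "linear (tangent_proj \<sigma>)"
  by (rule linearI) (auto simp: tangent_proj_def inner_add algebra_simps)

text \<open>This makes the choice inside \<open>frechet_derivative\<close> irrelevant:
  \<open>tgrad\<close> and \<open>tdiv\<close> can be computed from any derivative at hand, in
  particular from that of an ambient extension.\<close>

lemma frechet_derivative_sphere:
  assumes "(f has_derivative D) (at \<sigma> within sphere 0 1)" "norm \<sigma> = 1"
  shows "frechet_derivative f (at \<sigma> within sphere 0 1) (tangent_proj \<sigma> b) = D (tangent_proj \<sigma> b)"
proof -
  have "(f has_derivative frechet_derivative f (at \<sigma> within sphere 0 1)) (at \<sigma> within sphere 0 1)"
    using assms(1) frechet_derivative_works differentiable_def by blast
  from sphere_derivative_unique[OF this assms tangent_proj_orthogonal[OF assms(2)]] show ?thesis .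
qed

lemma tgrad_eq:
  assumes D: "(f has_derivative (\<lambda>h. G \<bullet> h)) (at \<sigma> within sphere 0 1)" and \<sigma>: "norm \<sigma> = 1"
  shows "tgrad f \<sigma> = tangent_proj \<sigma> G"
  unfolding tgrad_def frechet_derivative_sphere[OF D \<sigma>] tangent_proj_selfadjoint[symmetric]
  by (rule euclidean_representation)

lemma tdiv_eq:
  assumes D: "(X has_derivative D) (at \<sigma> within sphere 0 1)" and \<sigma>: "norm \<sigma> = 1"
  shows "tdiv X \<sigma> = (\<Sum>b\<in>Basis. D (tangent_proj \<sigma> b) \<bullet> b)"
  unfolding tdiv_def frechet_derivative_sphere[OF D \<sigma>] ..

text \<open>The left side is the trace of the rank-one map sending \<open>v\<close> to
  \<open>L (tangent_proj \<sigma> v)\<close> times \<open>c\<close>. Linearity reduces it to the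
  expansion of \<open>c\<close> in the basis.\<close>

lemma sum_tangent_proj_inner:
  assumes "linear L" "norm \<sigma> = 1"
  shows "(\<Sum>b\<in>Basis. L (tangent_proj \<sigma> b) * (c \<bullet> b)) = (L (tangent_proj \<sigma> c) :: real)"
proof -
  have "(\<Sum>b\<in>Basis. L (tangent_proj \<sigma> b) * (c \<bullet> b)) = L (tangent_proj \<sigma> (\<Sum>b\<in>Basis. (c \<bullet> b) *\<^sub>R b))"
    using assms(1) linear_tangent_proj[of \<sigma>]
    by (simp add: linear_sum linear_scale algebra_simps)
  then show ?thesis by (simp add: euclidean_representation)
qed

lemma trace_tangent_proj:
  fixes \<sigma> :: "'a::euclidean_space"
  assumes "norm \<sigma> = 1"
  shows "(\<Sum>b\<in>Basis. tangent_proj \<sigma> b \<bullet> b) = real DIM('a) - 1"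
proof -
  have 1: "(\<Sum>b\<in>Basis. (b \<bullet> \<sigma>) * (\<sigma> \<bullet> b)) = 1"
    using euclidean_inner[of \<sigma> \<sigma>] assms by (simp add: inner_commute dot_square_norm)
  have "(\<Sum>b\<in>Basis. tangent_proj \<sigma> b \<bullet> b) = (\<Sum>b\<in>Basis. 1 - (b \<bullet> \<sigma>) * (\<sigma> \<bullet> b))"
    by (intro sum.cong refl) (simp add: tangent_proj_def inner_diff_left)
  with 1 show ?thesis by (simp add: sum_subtractf)
qed

lemma tangent_proj_inner_proj:
  assumes "norm \<sigma> = 1"
  shows "tangent_proj \<sigma> v \<bullet> tangent_proj \<sigma> w = tangent_proj \<sigma> v \<bullet> w"
  using tangent_proj_fixes[OF tangent_proj_orthogonal[OF assms]] tangent_proj_selfadjoint by metis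

text \<open>Near \<sigma> the field has a differentiable ambient extension, to which the product
  rule applies. Differentiating the weight gives a rank-one term whose trace is its value at
  \<open>T\<close>. The spherical Hessian is the ambient one minus
  \<open>(G \<sigma> \<bullet> \<sigma>)\<close> times the metric, which accounts for both
  correction terms.\<close>

lemma tdiv_p_weight_tgrad:
  fixes g \<psi> :: "'a::euclidean_space \<Rightarrow> real" and G :: "'a \<Rightarrow> 'a" and H :: "'a \<Rightarrow>\<^sub>L 'a"
  assumes \<sigma>: "norm \<sigma> = 1" and \<rho>: "\<rho> > 0" and \<beta>: "\<beta> > 0"
    and eq: "\<And>y. y \<in> sphere 0 1 \<Longrightarrow> dist y \<sigma> < \<rho> \<Longrightarrow> \<psi> y = g y"
    and g: "\<And>y. dist y \<sigma> < \<rho> \<Longrightarrow> (g has_derivative (\<lambda>h. G y \<bullet> h)) (at y)"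
    and G: "(G has_derivative blinfun_apply H) (at \<sigma>)"
    and pos: "g \<sigma> > 0"
  defines "T \<equiv> tangent_proj \<sigma> (G \<sigma>)"
  defines "Q \<equiv> \<beta>\<^sup>2 * (g \<sigma>)\<^sup>2 + (norm T)\<^sup>2"
  shows "tgrad \<psi> \<sigma> = T"
    and "tdiv (\<lambda>y. p_weight p \<beta> \<psi> y *\<^sub>R tgrad \<psi> y) \<sigma> =
      Q powr ((p - 2) / 2) *
       ((p - 2) * (\<beta>\<^sup>2 * g \<sigma> * (T \<bullet> T) + (H T \<bullet> T - (G \<sigma> \<bullet> \<sigma>) * (T \<bullet> T))) / Q
        + (\<Sum>b\<in>Basis. H (tangent_proj \<sigma> b) \<bullet> tangent_proj \<sigma> b) - (real DIM('a) - 1) * (G \<sigma> \<bullet> \<sigma>))"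
proof -
  have grad: "tgrad \<psi> y = tangent_proj y (G y)" if y: "y \<in> sphere 0 1" "dist y \<sigma> < \<rho>" for y
  proof (rule tgrad_eq)
    have "(g has_derivative (\<lambda>h. G y \<bullet> h)) (at y within sphere 0 1)"
      using g[OF y(2)] by (rule has_derivative_at_withinI)
    then show "(\<psi> has_derivative (\<lambda>h. G y \<bullet> h)) (at y within sphere 0 1)"
    proof (rule has_derivative_transform_within)
      show "0 < \<rho> - dist y \<sigma>" using y by simp
      show "g x = \<psi> x" if "x \<in> sphere 0 1" "dist x y < \<rho> - dist y \<sigma>" for x
        using eq[OF that(1)] that(2) dist_triangle[of x \<sigma> y] by auto
    qed (use y in auto)
    show "norm y = 1" using y by simp
  qed
  have \<sigma>S: "\<sigma> \<in> sphere 0 1" using \<sigma> by simp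
  show tT: "tgrad \<psi> \<sigma> = T" using grad[OF \<sigma>S] \<rho> by (simp add: T_def)
  define D where "D = (\<lambda>v. H v - ((H v \<bullet> \<sigma> + G \<sigma> \<bullet> v) *\<^sub>R \<sigma> + (G \<sigma> \<bullet> \<sigma>) *\<^sub>R v))"
  \<comment> \<open>The formula for the tangential gradient makes sense off the sphere and is
    differentiable at \<sigma> there.\<close>
  define t where "t = (\<lambda>y. G y - (G y \<bullet> y) *\<^sub>R y)"
  have tD: "(t has_derivative D) (at \<sigma>)"
    unfolding t_def D_def
    by (auto intro!: derivative_eq_intros G simp: algebra_simps)
  have t\<sigma>: "t \<sigma> = T" by (simp add: t_def T_def tangent_proj_def)
  define q where "q = (\<lambda>y. \<beta>\<^sup>2 * (g y)\<^sup>2 + t y \<bullet> t y)"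
  have q\<sigma>: "q \<sigma> = Q" by (simp add: q_def Q_def t\<sigma> dot_square_norm)
  have Q: "Q > 0" using pos \<beta> by (simp add: Q_def add_pos_nonneg)
  define Dq where "Dq = (\<lambda>v. \<beta>\<^sup>2 * (2 * g \<sigma> * (G \<sigma> \<bullet> v)) + 2 * (T \<bullet> D v))"
  have g\<sigma>: "(g has_derivative (\<lambda>h. G \<sigma> \<bullet> h)) (at \<sigma>)" using g[of \<sigma>] \<rho> by simp
  have qD: "(q has_derivative Dq) (at \<sigma>)"
    unfolding q_def Dq_def
    by (auto intro!: derivative_eq_intros g\<sigma> tD simp: t\<sigma> inner_commute algebra_simps)
  define W where "W = Q powr ((p - 2) / 2)"
  define DX where "DX = (\<lambda>v. W *\<^sub>R D v + (W * (Dq v * ((p - 2) / 2) / Q)) *\<^sub>R T)"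
  have XD: "((\<lambda>y. q y powr ((p - 2) / 2) *\<^sub>R t y) has_derivative DX) (at \<sigma>)"
    unfolding DX_def W_def
    using Q by (auto intro!: derivative_eq_intros qD tD simp: t\<sigma> q\<sigma>)
  have "((\<lambda>y. p_weight p \<beta> \<psi> y *\<^sub>R tgrad \<psi> y) has_derivative DX) (at \<sigma> within sphere 0 1)"
  proof (rule has_derivative_transform_within[OF has_derivative_at_withinI[OF XD] \<rho> \<sigma>S])
    fix y assume y: "y \<in> sphere (0::'a) 1" "dist y \<sigma> < \<rho>"
    show "q y powr ((p - 2) / 2) *\<^sub>R t y = p_weight p \<beta> \<psi> y *\<^sub>R tgrad \<psi> y"
      unfolding p_weight_def grad[OF y] eq[OF y] q_def t_def tangent_proj_def dot_square_norm ..
  qed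
  from tdiv_eq[OF this \<sigma>]
  have 1: "tdiv (\<lambda>y. p_weight p \<beta> \<psi> y *\<^sub>R tgrad \<psi> y) \<sigma>
      = W * ((\<Sum>b\<in>Basis. D (tangent_proj \<sigma> b) \<bullet> b) + (p - 2) / (2 * Q) * (\<Sum>b\<in>Basis. Dq (tangent_proj \<sigma> b) * (T \<bullet> b)))"
  proof -
    have "DX u \<bullet> b = W * (D u \<bullet> b + (p - 2) / (2 * Q) * (Dq u * (T \<bullet> b)))" for u b
      by (simp add: DX_def inner_add_left algebra_simps)
    then show ?thesis
      unfolding \<open>tdiv _ \<sigma> = _\<close> by (simp only: sum.distrib sum_distrib_left[symmetric])
  qed
  have T\<sigma>: "T \<bullet> \<sigma> = 0" using tangent_proj_orthogonal[OF \<sigma>] by (simp add: T_def)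
  have GT: "G \<sigma> \<bullet> T = T \<bullet> T"
    using tangent_proj_inner_proj[OF \<sigma>, of "G \<sigma>" "G \<sigma>"] by (simp add: T_def inner_commute)
  have lH: "linear (\<lambda>v. H v \<bullet> w)" for w
    by (intro linearI) (auto simp: blinfun.bilinear_simps inner_add)
  have lDq: "linear Dq"
    using qD has_derivative_linear by blast
  have 2: "(\<Sum>b\<in>Basis. Dq (tangent_proj \<sigma> b) * (T \<bullet> b)) = Dq T"
    using sum_tangent_proj_inner[OF lDq \<sigma>, of T] tangent_proj_fixes[OF T\<sigma>] by simp
  have 3: "Dq T = 2 * (\<beta>\<^sup>2 * g \<sigma> * (T \<bullet> T) + (H T \<bullet> T - (G \<sigma> \<bullet> \<sigma>) * (T \<bullet> T)))"
    unfolding Dq_def D_def GT using T\<sigma> by (simp add: inner_diff_right inner_add_right inner_commute algebra_simps)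
  \<comment> \<open>Rank-one terms with values along \<sigma> have trace equal to a linear form at
    this vector, hence zero. This removes the normal parts in \<open>n1\<close> and
    \<open>n2\<close>.\<close>
  have P\<sigma>: "tangent_proj \<sigma> \<sigma> = 0" using \<sigma> by (simp add: tangent_proj_def dot_square_norm)
  have n1: "(\<Sum>b\<in>Basis. (H (tangent_proj \<sigma> b) \<bullet> \<sigma> + G \<sigma> \<bullet> tangent_proj \<sigma> b) * (\<sigma> \<bullet> b)) = 0"
    using sum_tangent_proj_inner[OF _ \<sigma>, of "\<lambda>v. H v \<bullet> \<sigma> + G \<sigma> \<bullet> v" \<sigma>] lH[of \<sigma>] P\<sigma>
    by (simp add: linear_compose_add linear_iff inner_add_right blinfun.bilinear_simps inner_add_left algebra_simps)
  have n2: "(\<Sum>b\<in>Basis. H (tangent_proj \<sigma> b) \<bullet> tangent_proj \<sigma> b) = (\<Sum>b\<in>Basis. H (tangent_proj \<sigma> b) \<bullet> b)"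
  proof -
    have "(\<Sum>b\<in>Basis. H (tangent_proj \<sigma> b) \<bullet> tangent_proj \<sigma> b)
      = (\<Sum>b\<in>Basis. H (tangent_proj \<sigma> b) \<bullet> b - (H (tangent_proj \<sigma> b) \<bullet> \<sigma>) * (\<sigma> \<bullet> b))"
      by (intro sum.cong refl) (subst (2) tangent_proj_def, simp add: inner_diff_right inner_commute)
    also have "\<dots> = (\<Sum>b\<in>Basis. H (tangent_proj \<sigma> b) \<bullet> b)"
      using sum_tangent_proj_inner[OF lH[of \<sigma>] \<sigma>, of \<sigma>] P\<sigma> by (simp add: sum_subtractf)
    finally show ?thesis .
  qed
  have "(\<Sum>b\<in>Basis. D (tangent_proj \<sigma> b) \<bullet> b) = (\<Sum>b\<in>Basis. H (tangent_proj \<sigma> b) \<bullet> b)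
     - (\<Sum>b\<in>Basis. (H (tangent_proj \<sigma> b) \<bullet> \<sigma> + G \<sigma> \<bullet> tangent_proj \<sigma> b) * (\<sigma> \<bullet> b))
     - (G \<sigma> \<bullet> \<sigma>) * (\<Sum>b\<in>Basis. tangent_proj \<sigma> b \<bullet> b)"
    unfolding D_def by (simp add: inner_diff_left inner_add_left sum_subtractf sum.distrib sum_distrib_left)
  also have "\<dots> = (\<Sum>b\<in>Basis. H (tangent_proj \<sigma> b) \<bullet> tangent_proj \<sigma> b) - (real DIM('a) - 1) * (G \<sigma> \<bullet> \<sigma>)"
    unfolding n1 n2 trace_tangent_proj[OF \<sigma>] by simp
  finally have 4: "(\<Sum>b\<in>Basis. D (tangent_proj \<sigma> b) \<bullet> b) =
     (\<Sum>b\<in>Basis. H (tangent_proj \<sigma> b) \<bullet> tangent_proj \<sigma> b) - (real DIM('a) - 1) * (G \<sigma> \<bullet> \<sigma>)" .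
  show "tdiv (\<lambda>y. p_weight p \<beta> \<psi> y *\<^sub>R tgrad \<psi> y) \<sigma> =
      Q powr ((p - 2) / 2) *
       ((p - 2) * (\<beta>\<^sup>2 * g \<sigma> * (T \<bullet> T) + (H T \<bullet> T - (G \<sigma> \<bullet> \<sigma>) * (T \<bullet> T))) / Q
        + (\<Sum>b\<in>Basis. H (tangent_proj \<sigma> b) \<bullet> tangent_proj \<sigma> b) - (real DIM('a) - 1) * (G \<sigma> \<bullet> \<sigma>))"
  proof -
    have 5: "(p - 2) / (2 * Q) * (2 * Z) = (p - 2) * Z / Q" for Z by simp
    show ?thesis
      unfolding 1 2 3 4 5 W_def[symmetric]
      by (rule arg_cong[where f = "(*) W"]) linarith
  qed
qed

section \<open>First- and second-order conditions at a contact point\<close>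

text \<open>If \<open>D\<close> were positive, \<open>f'\<close> would be positive just to the right
  of 0, and the mean value theorem would give a value of \<open>f\<close> above
  \<open>f 0\<close>.\<close>

lemma local_max_second_derivative:
  fixes f f' :: "real \<Rightarrow> real"
  assumes d: "d > 0" and f: "\<And>r. \<bar>r\<bar> < d \<Longrightarrow> (f has_real_derivative f' r) (at r)"
    and f': "(f' has_real_derivative D) (at 0)"
    and max: "\<And>r. \<bar>r\<bar> < d \<Longrightarrow> f r \<le> f 0"
  shows "f' 0 = 0" "D \<le> 0"
proof -
  show f0: "f' 0 = 0"
    using DERIV_local_max[OF f[of 0] d] d max by auto
  show "D \<le> 0"
  proof (rule ccontr)
    assume "\<not> D \<le> 0"
    then obtain c where c: "c > 0" "\<And>r. 0 < r \<Longrightarrow> r < c \<Longrightarrow> 0 < f' r"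
      using DERIV_pos_inc_right[OF f'] f0 by auto
    define m where "m = min c d / 2"
    have m: "m > 0" "m < c" "m < d" using c d by (auto simp: m_def)
    have "\<exists>z>0. z < m \<and> f m - f 0 = (m - 0) * f' z"
      by (rule MVT2) (use m f in auto)
    then obtain z where "0 < z" "z < m" "f m - f 0 = m * f' z" by auto
    moreover have "f m \<le> f 0" using max m by auto
    moreover have "m * f' z > 0" using c(2)[of z] calculation m by simp
    ultimately show False by simp
  qed
qed

text \<open>Restricting \<open>\<epsilon> * (h - ln g / \<beta>)\<close> to the great circle through
  \<sigma> with velocity \<open>v\<close> gives a function of one variable with a maximum at 0. The
  two conclusions are its first- and second-order conditions.\<close>

lemma sphere_contact:
  fixes g :: "'a::euclidean_space \<Rightarrow> real" and G :: "'a \<Rightarrow> 'a" and H :: "'a \<Rightarrow>\<^sub>L 'a"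
  assumes \<sigma>: "norm \<sigma> = 1" and \<rho>: "\<rho> > 0" and \<beta>: "\<beta> > 0" and \<epsilon>: "\<epsilon> = 1 \<or> \<epsilon> = (-1::real)"
    and g: "\<And>y. dist y \<sigma> < \<rho> \<Longrightarrow> (g has_derivative (\<lambda>h. G y \<bullet> h)) (at y)"
    and G: "(G has_derivative blinfun_apply H) (at \<sigma>)"
    and pos: "\<And>y. dist y \<sigma> < \<rho> \<Longrightarrow> g y > 0"
    and h: "\<And>y. dist y \<sigma> < \<rho> \<Longrightarrow> (h has_real_derivative h1 (y \<bullet> e)) (at (y \<bullet> e))"
    and h1: "(h1 has_real_derivative h2) (at (\<sigma> \<bullet> e))"
    and contact: "\<And>y. y \<in> sphere 0 1 \<Longrightarrow> dist y \<sigma> < \<rho> \<Longrightarrow>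
       \<epsilon> * (h (y \<bullet> e) - ln (g y) / \<beta>) \<le> \<epsilon> * (h (\<sigma> \<bullet> e) - ln (g \<sigma>) / \<beta>)"
    and v: "norm v = 1" "v \<bullet> \<sigma> = 0"
  shows "G \<sigma> \<bullet> v = \<beta> * g \<sigma> * h1 (\<sigma> \<bullet> e) * (v \<bullet> e)"
    and "\<epsilon> * ((H v \<bullet> v - G \<sigma> \<bullet> \<sigma>) / (\<beta> * g \<sigma>) - (G \<sigma> \<bullet> v)\<^sup>2 / (\<beta> * (g \<sigma>)\<^sup>2)
            - h2 * (v \<bullet> e)\<^sup>2 + h1 (\<sigma> \<bullet> e) * (\<sigma> \<bullet> e)) \<ge> 0"
proof -
  define c where "c = (\<lambda>r. cos r *\<^sub>R \<sigma> + sin r *\<^sub>R v)"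
  define c' where "c' = (\<lambda>r. cos r *\<^sub>R v - sin r *\<^sub>R \<sigma>)"
  have c0: "c 0 = \<sigma>" "c' 0 = v" by (auto simp: c_def c'_def)
  have cS: "c r \<in> sphere 0 1" for r
    unfolding c_def using great_circle_in_sphere[OF \<sigma> v] .
  have dc: "(c has_derivative (\<lambda>x. x *\<^sub>R c' r)) (at r)" for r
    using great_circle_derivative[of \<sigma> v r] by (simp add: c_def c'_def has_vector_derivative_def)
  \<comment> \<open>The acceleration of a great circle is \<open>- c\<close>. This is the source of
    the terms \<open>G \<sigma> \<bullet> \<sigma>\<close> and
    \<open>h1 (\<sigma> \<bullet> e) * (\<sigma> \<bullet> e)\<close>.\<close>
  have dc': "(c' has_derivative (\<lambda>x. x *\<^sub>R (- c r))) (at r)" for r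
    unfolding c_def c'_def by (auto intro!: derivative_eq_intros simp: algebra_simps)
  have "isCont c 0" using has_derivative_continuous[OF dc] .
  then obtain d where d: "d > 0" and "\<And>r. dist r 0 < d \<Longrightarrow> dist (c r) (c 0) < \<rho>"
    unfolding continuous_at_eps_delta using \<rho> by (metis dist_commute)
  then have near: "dist (c r) \<sigma> < \<rho>" if "\<bar>r\<bar> < d" for r using that c0 by simp
  have dG: "((\<lambda>r. G (c r)) has_derivative (\<lambda>x. x *\<^sub>R H v)) (at 0)"
    using has_derivative_compose[OF dc[of 0], of G H] G c0 by (simp add: blinfun.bilinear_simps)
  have dg: "((\<lambda>r. g (c r)) has_real_derivative G (c r) \<bullet> c' r) (at r)" if "\<bar>r\<bar> < d" for r
    using has_derivative_compose[OF dc[of r] g[OF near[OF that]]]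
    by (simp add: has_field_derivative_def mult.commute[of _ "G (c r) \<bullet> c' r"])
  have de: "((\<lambda>r. c r \<bullet> e) has_real_derivative c' r \<bullet> e) (at r)" for r
    using has_derivative_inner_left[OF dc[of r], of e]
    by (simp add: has_field_derivative_def mult.commute[of _ "c' r \<bullet> e"])
  have de': "((\<lambda>r. c' r \<bullet> e) has_real_derivative - (c r \<bullet> e)) (at r)" for r
    using has_derivative_inner_left[OF dc'[of r], of e]
    unfolding has_field_derivative_def by (rule has_derivative_eq_rhs) auto
  have dh: "((\<lambda>r. h (c r \<bullet> e)) has_real_derivative h1 (c r \<bullet> e) * (c' r \<bullet> e)) (at r)" if "\<bar>r\<bar> < d" for r
    using DERIV_chain2[OF h[OF near[OF that]] de] .
  have dh1: "((\<lambda>r. h1 (c r \<bullet> e)) has_real_derivative h2 * (v \<bullet> e)) (at 0)"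
    using DERIV_chain2[of h1 h2 "\<lambda>r. c r \<bullet> e" 0, OF _ de] h1 c0 by simp
  have dGc: "((\<lambda>r. G (c r) \<bullet> c' r) has_real_derivative H v \<bullet> v - G \<sigma> \<bullet> \<sigma>) (at 0)"
    using has_derivative_inner[OF dG dc'[of 0]]
    unfolding has_field_derivative_def by (rule has_derivative_eq_rhs) (auto simp: c0 algebra_simps)
  define f where "f = (\<lambda>r. \<epsilon> * (h (c r \<bullet> e) - ln (g (c r)) / \<beta>))"
  define f1 where "f1 = (\<lambda>r. \<epsilon> * (h1 (c r \<bullet> e) * (c' r \<bullet> e) - (G (c r) \<bullet> c' r) / g (c r) / \<beta>))"
  define D where "D = \<epsilon> * (h2 * (v \<bullet> e) * (v \<bullet> e) - h1 (\<sigma> \<bullet> e) * (\<sigma> \<bullet> e)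
     - ((H v \<bullet> v - G \<sigma> \<bullet> \<sigma>) * g \<sigma> - (G \<sigma> \<bullet> v) * (G \<sigma> \<bullet> v)) / (g \<sigma> * g \<sigma>) / \<beta>)"
  have f: "(f has_real_derivative f1 r) (at r)" if r: "\<bar>r\<bar> < d" for r
    unfolding f_def f1_def using pos[OF near[OF r]] \<beta>
    by (auto intro!: derivative_eq_intros dh[OF r] dg[OF r] simp: field_simps)
  have f1: "(f1 has_real_derivative D) (at 0)"
    unfolding f1_def D_def using pos[of \<sigma>] \<rho> \<beta> c0 dg[of 0] d
    by (auto intro!: derivative_eq_intros dh1 de' dGc dg simp: field_simps)
  have max: "f r \<le> f 0" if "\<bar>r\<bar> < d" for r
    unfolding f_def using contact[OF cS near[OF that]] c0 by simp
  note conc = local_max_second_derivative[OF d f f1 max]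
  have p: "g \<sigma> > 0" using pos[of \<sigma>] \<rho> by simp
  have "h1 (\<sigma> \<bullet> e) * (v \<bullet> e) - (G \<sigma> \<bullet> v) / g \<sigma> / \<beta> = 0" using conc(1) \<epsilon> by (auto simp: f1_def c0)
  then show "G \<sigma> \<bullet> v = \<beta> * g \<sigma> * h1 (\<sigma> \<bullet> e) * (v \<bullet> e)"
    using p \<beta> by (simp add: field_simps)
  have "D = - (\<epsilon> * ((H v \<bullet> v - G \<sigma> \<bullet> \<sigma>) / (\<beta> * g \<sigma>) - (G \<sigma> \<bullet> v)\<^sup>2 / (\<beta> * (g \<sigma>)\<^sup>2)
            - h2 * (v \<bullet> e)\<^sup>2 + h1 (\<sigma> \<bullet> e) * (\<sigma> \<bullet> e)))"
    unfolding D_def using p \<beta> by (simp add: field_simps power2_eq_square)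
  with conc(2) show "\<epsilon> * ((H v \<bullet> v - G \<sigma> \<bullet> \<sigma>) / (\<beta> * g \<sigma>) - (G \<sigma> \<bullet> v)\<^sup>2 / (\<beta> * (g \<sigma>)\<^sup>2)
            - h2 * (v \<bullet> e)\<^sup>2 + h1 (\<sigma> \<bullet> e) * (\<sigma> \<bullet> e)) \<ge> 0" by simp
qed

text \<open>
  The vectors \<open>P b\<close> are not orthonormal, so Lagrange's identity replaces diagonalisation. It also
  avoids symmetry of \<open>B\<close>.
\<close>

lemma quadratic_form_le_trace:
  fixes B :: "'a::euclidean_space \<Rightarrow> 'a \<Rightarrow> real" and P :: "'a \<Rightarrow> 'a"
  assumes B: "bounded_bilinear B" and psd: "\<And>v. B (P v) (P v) \<ge> 0" and P: "linear P"
  shows "B (P a) (P a) \<le> (a \<bullet> a) * (\<Sum>b\<in>Basis. B (P b) (P b))"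
proof -
  interpret bounded_bilinear B by (rule B)
  let ?x = "\<lambda>b. P b" and ?c = "\<lambda>b. a \<bullet> b"
  have Pa: "P a = (\<Sum>b\<in>Basis. ?c b *\<^sub>R ?x b)"
    using P by (metis (no_types, lifting) euclidean_representation linear_sum linear_scale sum.cong)
  have 1: "(\<Sum>b\<in>Basis. \<Sum>d\<in>Basis. ?c b * ?c d * B (?x b) (?x d)) = B (P a) (P a)"
    unfolding Pa sum_left sum_right scaleR_left scaleR_right
    by (subst sum.swap) (auto simp: sum_distrib_left intro!: sum.cong)
  have 3: "(\<Sum>b\<in>Basis. \<Sum>d\<in>Basis. ?c b * ?c d * B (?x d) (?x b)) = B (P a) (P a)"
    unfolding 1[symmetric] by (subst sum.swap) (simp add: mult.commute)
  have 2: "(\<Sum>b\<in>Basis. \<Sum>d\<in>Basis. (?c b)\<^sup>2 * B (?x d) (?x d)) = (a \<bullet> a) * (\<Sum>b\<in>Basis. B (?x b) (?x b))"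
    by (subst euclidean_inner) (simp add: sum_product power2_eq_square)
  have 4: "(\<Sum>b\<in>Basis. \<Sum>d\<in>Basis. (?c d)\<^sup>2 * B (?x b) (?x b)) = (a \<bullet> a) * (\<Sum>b\<in>Basis. B (?x b) (?x b))"
    unfolding 2[symmetric] by (rule sum.swap)
  \<comment> \<open>Each pair of basis vectors contributes the form at the image of a vector
    orthogonal to \<open>a\<close>. Square terms add up to twice the trace bound, mixed terms to
    twice \<open>B (P a) (P a)\<close>.\<close>
  have "0 \<le> (\<Sum>b\<in>Basis. \<Sum>d\<in>Basis. B (P (?c b *\<^sub>R d - ?c d *\<^sub>R b)) (P (?c b *\<^sub>R d - ?c d *\<^sub>R b)))"
    by (intro sum_nonneg psd)
  also have "\<dots> = (\<Sum>b\<in>Basis. \<Sum>d\<in>Basis. (?c b)\<^sup>2 * B (?x d) (?x d) + (?c d)\<^sup>2 * B (?x b) (?x b)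
      - ?c b * ?c d * B (?x b) (?x d) - ?c b * ?c d * B (?x d) (?x b))"
    using P by (simp add: linear_diff linear_scale diff_left diff_right scaleR_left scaleR_right power2_eq_square algebra_simps)
  also have "\<dots> = 2 * ((a \<bullet> a) * (\<Sum>b\<in>Basis. B (?x b) (?x b))) - 2 * B (P a) (P a)"
    unfolding sum.distrib sum_subtractf 1 2 3 4 by simp
  finally show ?thesis by simp
qed

subsection \<open>Contact with a barrier\<close>

lemma norm_tangent_proj: "norm e = 1 \<Longrightarrow> norm \<sigma> = 1 \<Longrightarrow> tangent_proj \<sigma> e \<bullet> tangent_proj \<sigma> e = 1 - (\<sigma> \<bullet> e)\<^sup>2"
  by (simp add: norm_eq_1 tangent_proj_def inner_diff inner_commute power2_eq_square)

lemma sum_tangent_proj_inner_squared: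
  "(\<Sum>b\<in>Basis. (w \<bullet> tangent_proj \<sigma> b)\<^sup>2) = tangent_proj \<sigma> w \<bullet> tangent_proj \<sigma> w"
  by (subst euclidean_inner) (simp add: tangent_proj_selfadjoint power2_eq_square)

text \<open>At the contact point the equation for \<psi> expresses the operator at \<open>h\<close>
  as \<open>- ((p - 2) * y^2 * k + q * m)\<close>, where \<open>k\<close> is the value on
  \<open>\<nu>\<close> and \<open>m\<close> the trace of the Hessian \<open>M\<close> of the
  difference. Since \<open>\<epsilon> * M\<close> is positive semidefinite on tangent vectors,
  ellipticity for \<open>p > 1\<close> fixes the sign.\<close>

lemma spherical_contact:
  fixes \<psi> :: "'a::euclidean_space \<Rightarrow> real"
  assumes sol: "spherical_p_harmonic e p \<beta> \<psi>" and \<beta>: "\<beta> > 0" and p: "p > 1" and e: "norm e = 1"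
    and \<sigma>U: "\<sigma> \<in> upper_hemisphere e" and \<epsilon>: "\<epsilon> = 1 \<or> \<epsilon> = (-1::real)" and \<rho>0: "\<rho>0 > 0"
    and h: "\<And>y. dist y \<sigma> < \<rho>0 \<Longrightarrow> (h has_real_derivative h1 (y \<bullet> e)) (at (y \<bullet> e))"
    and h1: "(h1 has_real_derivative h2) (at (\<sigma> \<bullet> e))"
    and contact: "\<And>y. y \<in> upper_hemisphere e \<Longrightarrow> dist y \<sigma> < \<rho>0 \<Longrightarrow>
       \<epsilon> * (h (y \<bullet> e) - ln (\<psi> y) / \<beta>) \<le> \<epsilon> * (h (\<sigma> \<bullet> e) - ln (\<psi> \<sigma>) / \<beta>)"
  shows "\<epsilon> * barrier_operator (real DIM('a)) p \<beta> (\<sigma> \<bullet> e) (h1 (\<sigma> \<bullet> e)) h2 \<le> 0"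
proof -
  have \<sigma>: "norm \<sigma> = 1" and te: "\<sigma> \<bullet> e > 0" using \<sigma>U by (auto simp: upper_hemisphere_def)
  obtain U g where U: "closed_hemisphere e \<subseteq> U" "C2_on_open U g"
    and g\<psi>: "\<And>y. y \<in> closed_hemisphere e \<Longrightarrow> g y = \<psi> y"
    using sol unfolding spherical_p_harmonic_def C2_on_closed_hemisphere_def by blast
  then obtain G H where "open U" and g: "\<And>y. y \<in> U \<Longrightarrow> (g has_derivative (\<lambda>h. G y \<bullet> h)) (at y)"
    and G: "\<And>y. y \<in> U \<Longrightarrow> (G has_derivative blinfun_apply (H y)) (at y)"
    unfolding C2_on_open_def by blast
  have up: "y \<in> closed_hemisphere e" if "y \<in> upper_hemisphere e" for y
    using that by (auto simp: upper_hemisphere_def closed_hemisphere_def)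
  have \<psi>pos: "\<psi> y > 0" if "y \<in> upper_hemisphere e" for y
    using sol that unfolding spherical_p_harmonic_def by blast
  have \<sigma>inU: "\<sigma> \<in> U" using up[OF \<sigma>U] U by blast
  have gpos: "g \<sigma> > 0" using \<psi>pos[OF \<sigma>U] g\<psi>[OF up[OF \<sigma>U]] by simp
  have "isCont g \<sigma>" using g[OF \<sigma>inU] has_derivative_continuous by blast
  then have "(g \<longlongrightarrow> g \<sigma>) (nhds \<sigma>)" by (simp add: isCont_def tendsto_at_iff_tendsto_nhds)
  then have "eventually (\<lambda>y. g y > 0) (nhds \<sigma>)"
    using gpos by (rule order_tendstoD)
  moreover have "eventually (\<lambda>y. y \<bullet> e > 0) (nhds \<sigma>)"
    using te by (intro order_tendstoD(1)[of _ "\<sigma> \<bullet> e"] tendsto_intros filterlim_ident)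
  moreover have "eventually (\<lambda>y. y \<in> U) (nhds \<sigma>)"
    using \<open>open U\<close> \<sigma>inU by (rule eventually_nhds_in_open)
  ultimately have "eventually (\<lambda>y. g y > 0 \<and> y \<bullet> e > 0 \<and> y \<in> U) (nhds \<sigma>)"
    by (intro eventually_conj)
  then obtain \<rho>1 where \<rho>1: "\<rho>1 > 0" "\<And>y. dist y \<sigma> < \<rho>1 \<Longrightarrow> g y > 0 \<and> y \<bullet> e > 0 \<and> y \<in> U"
    unfolding eventually_nhds_metric by blast
  define \<rho> where "\<rho> = min \<rho>0 \<rho>1"
  have \<rho>: "\<rho> > 0" using \<rho>0 \<rho>1 by (simp add: \<rho>_def)
  have near: "g y > 0" "y \<bullet> e > 0" "y \<in> U" "dist y \<sigma> < \<rho>0" if "dist y \<sigma> < \<rho>" for y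
    using \<rho>1(2)[of y] that by (auto simp: \<rho>_def)
  have upn: "y \<in> upper_hemisphere e" if "y \<in> sphere 0 1" "dist y \<sigma> < \<rho>" for y
    using that near(2)[OF that(2)] by (auto simp: upper_hemisphere_def)
  have g\<psi>n: "\<psi> y = g y" if "y \<in> sphere 0 1" "dist y \<sigma> < \<rho>" for y
    using g\<psi>[OF up[OF upn[OF that]]] by simp
  define t where "t = \<sigma> \<bullet> e"
  define s where "s = 1 - t\<^sup>2"
  define y where "y = h1 t"
  define \<gamma> where "\<gamma> = g \<sigma>"
  define \<eta> where "\<eta> = G \<sigma> \<bullet> \<sigma>"
  define n where "n = real DIM('a)"
  let ?H = "blinfun_apply (H \<sigma>)"
  \<comment> \<open>\<open>M\<close> is the Hessian on the sphere of \<open>ln \<psi> / \<beta> - h\<close> at the contact point.\<close>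
  define M where "M = (\<lambda>v w. (?H v \<bullet> w - \<eta> * (v \<bullet> w)) / (\<beta> * \<gamma>) - (G \<sigma> \<bullet> v) * (G \<sigma> \<bullet> w) / (\<beta> * \<gamma>\<^sup>2)
            - h2 * ((v \<bullet> e) * (w \<bullet> e)) + y * t * (v \<bullet> w))"
  have \<gamma>: "\<gamma> > 0" using gpos by (simp add: \<gamma>_def)
  have gn: "(g has_derivative (\<lambda>h. G y \<bullet> h)) (at y)" if "dist y \<sigma> < \<rho>" for y
    using g[OF near(3)[OF that]] .
  have hn: "(h has_real_derivative h1 (y \<bullet> e)) (at (y \<bullet> e))" if "dist y \<sigma> < \<rho>" for y
    using h[OF near(4)[OF that]] .
  have unit: "G \<sigma> \<bullet> v = \<beta> * \<gamma> * y * (v \<bullet> e) \<and> \<epsilon> * M v v \<ge> 0" if v: "norm v = 1" "v \<bullet> \<sigma> = 0" for v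
  proof -
    have c: "\<epsilon> * (h (z \<bullet> e) - ln (g z) / \<beta>) \<le> \<epsilon> * (h (\<sigma> \<bullet> e) - ln (g \<sigma>) / \<beta>)"
      if z: "z \<in> sphere 0 1" "dist z \<sigma> < \<rho>" for z
      using contact[OF upn[OF z] near(4)[OF z(2)]] g\<psi>n[OF z] g\<psi>n[of \<sigma>] \<sigma> \<rho> by simp
    have "v \<bullet> v = 1" using v by (simp add: norm_eq_1)
    then have M: "M v v = (?H v \<bullet> v - \<eta>) / (\<beta> * \<gamma>) - (G \<sigma> \<bullet> v)\<^sup>2 / (\<beta> * \<gamma>\<^sup>2)
            - h2 * (v \<bullet> e)\<^sup>2 + y * t"
      by (simp only: M_def mult_1_right power2_eq_square)
    show ?thesis
      unfolding M unfolding y_def t_def \<eta>_def \<gamma>_def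
      using sphere_contact[OF \<sigma> \<rho> \<beta> \<epsilon> gn G[OF \<sigma>inU] near(1) hn h1 c v] by (rule conjI)
  qed
  have tang: "G \<sigma> \<bullet> v = \<beta> * \<gamma> * y * (v \<bullet> e) \<and> \<epsilon> * M v v \<ge> 0" if v: "v \<bullet> \<sigma> = 0" for v
  proof (cases "v = 0")
    case False
    define r u where "r = norm v" and "u = v /\<^sub>R norm v"
    have v: "v = r *\<^sub>R u" and "norm u = 1" "u \<bullet> \<sigma> = 0" using False v by (auto simp: r_def u_def)
    note un = unit[OF this(2,3)]
    have "M v v = r\<^sup>2 * M u u"
      unfolding M_def v by (simp add: blinfun.bilinear_simps field_simps power2_eq_square)
    then have "\<epsilon> * M v v = r\<^sup>2 * (\<epsilon> * M u u)" by simp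
    also have "\<dots> \<ge> 0" using un by (intro mult_nonneg_nonneg[OF zero_le_power2]) blast
    finally show ?thesis using un by (simp add: v)
  qed (simp add: M_def blinfun.bilinear_simps)
  define T where "T = tangent_proj \<sigma> (G \<sigma>)"
  define \<nu> where "\<nu> = tangent_proj \<sigma> e"
  have T\<sigma>: "T \<bullet> \<sigma> = 0" and \<nu>\<sigma>: "\<nu> \<bullet> \<sigma> = 0"
    using tangent_proj_orthogonal[OF \<sigma>] by (auto simp: T_def \<nu>_def)
  \<comment> \<open>The gradients agree: the difference of the two sides is tangent, and
    \<open>tang\<close> applied to it shows that its square vanishes.\<close>
  have T: "T = (\<beta> * \<gamma> * y) *\<^sub>R \<nu>"
  proof -
    let ?w = "T - (\<beta> * \<gamma> * y) *\<^sub>R \<nu>"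
    have w: "?w \<bullet> \<sigma> = 0" using T\<sigma> \<nu>\<sigma> by (simp add: inner_diff_left)
    have "T \<bullet> ?w = G \<sigma> \<bullet> ?w" "\<nu> \<bullet> ?w = e \<bullet> ?w"
      using tangent_proj_fixes[OF w] by (auto simp: T_def \<nu>_def tangent_proj_selfadjoint)
    then have "?w \<bullet> ?w = 0"
      using tang[OF w] by (subst inner_diff_left) (simp add: inner_commute)
    then show ?thesis by simp
  qed
  have \<nu>\<nu>: "\<nu> \<bullet> \<nu> = s" using norm_tangent_proj[OF e \<sigma>] by (simp add: \<nu>_def s_def t_def)
  have P\<nu>: "tangent_proj \<sigma> \<nu> = \<nu>" using tangent_proj_fixes[OF \<nu>\<sigma>] .
  have \<nu>e: "\<nu> \<bullet> e = s"
    using \<nu>\<nu> P\<nu> tangent_proj_selfadjoint[of \<sigma> \<nu> e] by (simp add: \<nu>_def)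
  have G\<nu>: "G \<sigma> \<bullet> \<nu> = \<beta> * \<gamma> * y * s" using tang[OF \<nu>\<sigma>] \<nu>e by simp
  define k m X Y where "k = M \<nu> \<nu>"
    and "m = (\<Sum>b\<in>Basis. M (tangent_proj \<sigma> b) (tangent_proj \<sigma> b))"
    and "X = ?H \<nu> \<bullet> \<nu> - \<eta> * s"
    and "Y = (\<Sum>b\<in>Basis. ?H (tangent_proj \<sigma> b) \<bullet> tangent_proj \<sigma> b) - (n - 1) * \<eta>"
  have "bilinear (\<lambda>v w. \<epsilon> * M v w)"
    unfolding bilinear_def M_def
    by (intro conjI allI linearI) (auto simp: blinfun.bilinear_simps inner_add algebra_simps add_divide_distrib diff_divide_distrib)
  then have bb: "bounded_bilinear (\<lambda>v w. \<epsilon> * M v w)" by (simp add: bilinear_conv_bounded_bilinear)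
  have psd: "\<epsilon> * M (tangent_proj \<sigma> v) (tangent_proj \<sigma> v) \<ge> 0" for v
    using tang[OF tangent_proj_orthogonal[OF \<sigma>]] by blast
  have km: "\<epsilon> * k \<le> s * (\<epsilon> * m)"
    using quadratic_form_le_trace[OF bb psd linear_tangent_proj, of \<nu>]
    by (simp add: k_def m_def P\<nu> \<nu>\<nu> sum_distrib_left)
  have k0: "\<epsilon> * k \<ge> 0" using psd[of \<nu>] by (simp add: k_def P\<nu>)
  have m0: "\<epsilon> * m \<ge> 0" unfolding m_def sum_distrib_left by (intro sum_nonneg psd)
  \<comment> \<open>Here and in \<open>mY\<close> the second-order terms of the equation are
    expressed by \<open>k\<close> and \<open>m\<close>, that is, by the profile plus the Hessian of
    the difference.\<close>
  have kX: "X = \<beta> * \<gamma> * (k + \<beta> * y\<^sup>2 * s\<^sup>2 + h2 * s\<^sup>2 - y * t * s)"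
    unfolding k_def M_def X_def G\<nu> \<nu>\<nu> \<nu>e using \<beta> \<gamma> by (simp add: field_simps power2_eq_square)
  have TT: "T \<bullet> T = \<beta>\<^sup>2 * \<gamma>\<^sup>2 * y\<^sup>2 * s" unfolding T by (simp add: \<nu>\<nu> power2_eq_square)
  have tr: "(\<Sum>b\<in>Basis. tangent_proj \<sigma> b \<bullet> tangent_proj \<sigma> b) = n - 1"
    using trace_tangent_proj[OF \<sigma>] tangent_proj_inner_proj[OF \<sigma>] by (simp add: n_def)
  have "m = Y / (\<beta> * \<gamma>) - (\<Sum>b\<in>Basis. (G \<sigma> \<bullet> tangent_proj \<sigma> b)\<^sup>2) / (\<beta> * \<gamma>\<^sup>2)
     - h2 * (\<Sum>b\<in>Basis. (e \<bullet> tangent_proj \<sigma> b)\<^sup>2) + y * t * (n - 1)"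
    unfolding m_def M_def Y_def tr[symmetric]
    by (simp add: sum.distrib sum_subtractf sum_distrib_left sum_divide_distrib diff_divide_distrib
        power2_eq_square inner_commute[of e] mult.commute[of _ \<eta>])
  also have "\<dots> = Y / (\<beta> * \<gamma>) - \<beta> * y\<^sup>2 * s - h2 * s + y * t * (n - 1)"
    unfolding sum_tangent_proj_inner_squared T_def[symmetric] \<nu>_def[symmetric] \<nu>\<nu> TT
    using \<beta> \<gamma> by (simp add: field_simps power2_eq_square)
  finally have mY: "Y = \<beta> * \<gamma> * (m + \<beta> * y\<^sup>2 * s + h2 * s - y * t * (n - 1))"
    using \<beta> \<gamma> by (simp add: field_simps)
  define q where "q = 1 + y\<^sup>2 * s"
  have s0: "s \<ge> 0" using \<nu>\<nu> inner_ge_zero by metis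
  have q: "q > 0" using s0 by (simp add: q_def add_pos_nonneg)
  have Q: "\<beta>\<^sup>2 * \<gamma>\<^sup>2 + (norm T)\<^sup>2 = \<beta>\<^sup>2 * \<gamma>\<^sup>2 * q"
    using TT by (simp add: dot_square_norm q_def algebra_simps)
  note div = tdiv_p_weight_tgrad[OF \<sigma> \<rho> \<beta> g\<psi>n gn G[OF \<sigma>inU] gpos, folded T_def]
  define W where "W = (\<beta>\<^sup>2 * \<gamma>\<^sup>2 * q) powr ((p - 2) / 2)"
  have W: "W > 0" using \<beta> \<gamma> q by (simp add: W_def)
  have \<psi>\<sigma>: "\<psi> \<sigma> = \<gamma>" using g\<psi>n[of \<sigma>] \<sigma> \<rho> by (simp add: \<gamma>_def)
  have pw: "p_weight p \<beta> \<psi> \<sigma> = W"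
    unfolding p_weight_def using div(1) Q \<psi>\<sigma> by (simp add: W_def \<gamma>_def)
  have HT: "?H T \<bullet> T - \<eta> * (T \<bullet> T) = \<beta>\<^sup>2 * \<gamma>\<^sup>2 * y\<^sup>2 * X"
    unfolding T X_def by (simp add: blinfun.bilinear_simps \<nu>\<nu> power2_eq_square algebra_simps)
  have td: "tdiv (\<lambda>y. p_weight p \<beta> \<psi> y *\<^sub>R tgrad \<psi> y) \<sigma>
      = W * ((p - 2) * (\<beta>\<^sup>2 * \<gamma> * (T \<bullet> T) + \<beta>\<^sup>2 * \<gamma>\<^sup>2 * y\<^sup>2 * X) / (\<beta>\<^sup>2 * \<gamma>\<^sup>2 * q) + Y)"
    using div(2)[of p] unfolding \<gamma>_def[symmetric] \<eta>_def[symmetric] HT Q W_def[symmetric]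
    unfolding Y_def n_def add_diff_eq .
  have "- tdiv (\<lambda>y. p_weight p \<beta> \<psi> y *\<^sub>R tgrad \<psi> y) \<sigma>
        - \<beta> * Lambda TYPE('a) p \<beta> * p_weight p \<beta> \<psi> \<sigma> * \<psi> \<sigma> = 0"
    using sol \<sigma>U unfolding spherical_p_harmonic_def by blast
  then have "W * ((p - 2) * (\<beta>\<^sup>2 * \<gamma> * (T \<bullet> T) + \<beta>\<^sup>2 * \<gamma>\<^sup>2 * y\<^sup>2 * X) / (\<beta>\<^sup>2 * \<gamma>\<^sup>2 * q) + Y
      + \<beta> * (\<beta> * (p - 1) + p - n) * \<gamma>) = 0"
    unfolding td pw \<psi>\<sigma> Lambda_def n_def by (simp add: algebra_simps)
  then have eq: "(p - 2) * (\<beta>\<^sup>2 * \<gamma> * (T \<bullet> T) + \<beta>\<^sup>2 * \<gamma>\<^sup>2 * y\<^sup>2 * X) / (\<beta>\<^sup>2 * \<gamma>\<^sup>2 * q) + Y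
      + \<beta> * (\<beta> * (p - 1) + p - n) * \<gamma> = 0" using W by simp
  define Z where "Z = y\<^sup>2 * (\<beta> * s + k + \<beta> * y\<^sup>2 * s\<^sup>2 + h2 * s\<^sup>2 - y * t * s) / q"
  have "(\<beta>\<^sup>2 * \<gamma> * (T \<bullet> T) + \<beta>\<^sup>2 * \<gamma>\<^sup>2 * y\<^sup>2 * X) / (\<beta>\<^sup>2 * \<gamma>\<^sup>2 * q) = \<beta> * \<gamma> * Z"
    unfolding TT kX Z_def using \<beta> \<gamma> q by (simp add: field_simps power2_eq_square)
  then have "(p - 2) * (\<beta>\<^sup>2 * \<gamma> * (T \<bullet> T) + \<beta>\<^sup>2 * \<gamma>\<^sup>2 * y\<^sup>2 * X) / (\<beta>\<^sup>2 * \<gamma>\<^sup>2 * q) = (p - 2) * (\<beta> * \<gamma> * Z)"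
    by (simp only: times_divide_eq_right[symmetric])
  from eq[unfolded this mY]
  have "\<beta> * \<gamma> * ((p - 2) * Z + (m + \<beta> * y\<^sup>2 * s + h2 * s - y * t * (n - 1)) + (\<beta> * (p - 1) + p - n)) = 0"
    by (simp add: algebra_simps)
  then have "(p - 2) * Z + (m + \<beta> * y\<^sup>2 * s + h2 * s - y * t * (n - 1)) + (\<beta> * (p - 1) + p - n) = 0"
    using \<beta> \<gamma> by simp
  then have "(p - 2) * (q * Z) + q * ((m + \<beta> * y\<^sup>2 * s + h2 * s - y * t * (n - 1)) + (\<beta> * (p - 1) + p - n)) = 0"
    by (metis add.assoc distrib_left mult.left_commute mult_zero_right)
  moreover have "q * Z = y\<^sup>2 * (\<beta> * s + k + \<beta> * y\<^sup>2 * s\<^sup>2 + h2 * s\<^sup>2 - y * t * s)"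
    using q by (simp add: Z_def)
  ultimately have "(p - 2) * (y\<^sup>2 * (\<beta> * s + k + \<beta> * y\<^sup>2 * s\<^sup>2 + h2 * s\<^sup>2 - y * t * s))
     + q * ((m + \<beta> * y\<^sup>2 * s + h2 * s - y * t * (n - 1)) + (\<beta> * (p - 1) + p - n)) = 0"
    by simp
  then have op: "barrier_operator n p \<beta> t y h2 = - ((p - 2) * y\<^sup>2 * k + q * m)"
    unfolding barrier_operator_def q_def s_def[symmetric] by (simp add: algebra_simps power2_eq_square)
  have E: "\<epsilon> * barrier_operator n p \<beta> t y h2 = - ((p - 2) * (y\<^sup>2 * (\<epsilon> * k)) + q * (\<epsilon> * m))"
    unfolding op by (simp add: algebra_simps)
  \<comment> \<open>As \<open>p - 2 > -1\<close>, the worst case is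
    \<open>- y^2 * s * (\<epsilon> * m)\<close>, which the part \<open>y^2 * s\<close> of
    \<open>q\<close> absorbs; \<open>\<epsilon> * m\<close> is left over.\<close>
  have "(p - 2) * (y\<^sup>2 * (\<epsilon> * k)) \<ge> (- 1) * (y\<^sup>2 * (\<epsilon> * k))"
    using p k0 by (intro mult_right_mono) auto
  moreover have "y\<^sup>2 * (\<epsilon> * k) \<le> y\<^sup>2 * (s * (\<epsilon> * m))" using km by (intro mult_left_mono) auto
  ultimately have "(p - 2) * (y\<^sup>2 * (\<epsilon> * k)) + q * (\<epsilon> * m) \<ge> \<epsilon> * m"
    unfolding q_def by (simp add: algebra_simps)
  with m0 E show ?thesis by (simp add: n_def t_def y_def)
qed

section \<open>Existence and exclusion of contact points\<close>

text \<open>For \<open>b > 0\<close> and \<kappa> > -1 this profile tends to minus infinity as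
  \<open>t\<close> decreases to \<tau>; for \<tau> < 0 it is finite on the whole interval from 0 to
  1.\<close>

definition barrier :: "real \<Rightarrow> real \<Rightarrow> real \<Rightarrow> real \<Rightarrow> real" where
  "barrier b \<kappa> \<tau> t = ((1 + \<kappa>) * ln (t - \<tau>) - 2 * \<kappa> * t) / b"

text \<open>The profile is built for \<open>b\<close>, the equation has exponent \<beta>. Changing
  the exponent adds \<open>(p - 1) * (\<beta> - b) * q^2\<close> to the operator, and
  \<open>\<epsilon> * b \<le> \<epsilon> * \<beta>\<close> gives this term the favourable sign. A
  contact would then contradict \<open>spherical_contact\<close>.\<close>

lemma barrier_no_contact:
  fixes \<psi> :: "'a::euclidean_space \<Rightarrow> real"
  assumes sol: "spherical_p_harmonic e p \<beta> \<psi>" and \<beta>: "\<beta> > 0" and p: "p > 1" and e: "norm e = 1"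
    and \<sigma>U: "\<sigma> \<in> upper_hemisphere e" and \<epsilon>: "\<epsilon> = 1 \<or> \<epsilon> = (-1::real)" and b: "b > 0" "\<epsilon> * b \<le> \<epsilon> * \<beta>"
    and \<tau>: "\<tau> < \<sigma> \<bullet> e"
    and pos: "\<epsilon> * barrier_poly (real DIM('a)) p b \<kappa> \<tau> (\<sigma> \<bullet> e) > 0"
    and contact: "\<And>y. y \<in> upper_hemisphere e \<Longrightarrow> \<tau> < y \<bullet> e \<Longrightarrow>
       \<epsilon> * (barrier b \<kappa> \<tau> (y \<bullet> e) - ln (\<psi> y) / \<beta>) \<le> \<epsilon> * (barrier b \<kappa> \<tau> (\<sigma> \<bullet> e) - ln (\<psi> \<sigma>) / \<beta>)"
  shows False
proof -
  define t where "t = \<sigma> \<bullet> e"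
  define n where "n = real DIM('a)"
  define h1 where "h1 = (\<lambda>t. ((1 + \<kappa>) / (t - \<tau>) - 2 * \<kappa>) / b)"
  define h2 where "h2 = - ((1 + \<kappa>) / (t - \<tau>)\<^sup>2) / b"
  have tt: "\<tau> < t" using \<tau> by (simp add: t_def)
  have near: "\<tau> < y \<bullet> e" if "dist y \<sigma> < t - \<tau>" for y
  proof -
    have "\<bar>(y - \<sigma>) \<bullet> e\<bar> \<le> dist y \<sigma>"
      using Cauchy_Schwarz_ineq2[of "y - \<sigma>" e] e by (simp add: dist_norm)
    then show ?thesis using that by (simp add: inner_diff_left t_def abs_le_iff)
  qed
  have h: "(barrier b \<kappa> \<tau> has_real_derivative h1 x) (at x)" if "\<tau> < x" for x
    unfolding barrier_def[abs_def] h1_def using that b(1)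
    by (auto intro!: derivative_eq_intros)
  have "((\<lambda>t. (1 + \<kappa>) / (t - \<tau>) - 2 * \<kappa>) has_real_derivative - ((1 + \<kappa>) / (t - \<tau>)\<^sup>2)) (at t)"
    using tt by (auto intro!: derivative_eq_intros simp: power2_eq_square minus_divide_left)
  then have h1: "(h1 has_real_derivative h2) (at t)"
    unfolding h1_def h2_def by (rule DERIV_cdivide)
  have le: "\<epsilon> * barrier_operator n p \<beta> t (h1 t) h2 \<le> 0"
    unfolding n_def t_def
    by (rule spherical_contact[OF sol \<beta> p e \<sigma>U \<epsilon>, of "t - \<tau>" "barrier b \<kappa> \<tau>"])
      (use tt h near h1 contact in \<open>auto simp: t_def\<close>)
  define q where "q = 1 + (h1 t)\<^sup>2 * (1 - t\<^sup>2)"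
  have op: "barrier_operator n p \<beta> t (h1 t) h2 = barrier_operator n p b t (h1 t) h2 + (p - 1) * (\<beta> - b) * q\<^sup>2"
    unfolding barrier_operator_def q_def[symmetric] by (simp add: algebra_simps power2_eq_square)
  have "\<epsilon> * barrier_operator n p \<beta> t (h1 t) h2
      = \<epsilon> * barrier_operator n p b t (h1 t) h2 + (p - 1) * (\<epsilon> * \<beta> - \<epsilon> * b) * q\<^sup>2"
    unfolding op by (simp add: algebra_simps)
  moreover have "(p - 1) * (\<epsilon> * \<beta> - \<epsilon> * b) * q\<^sup>2 \<ge> 0" using p b by simp
  moreover have "\<epsilon> * barrier_operator n p b t (h1 t) h2 > 0"
  proof -
    have "barrier_operator n p b t (h1 t) h2 = barrier_poly n p b \<kappa> \<tau> t / (b ^ 3 * (t - \<tau>) ^ 4)"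
      unfolding h1_def h2_def using barrier_operator_eq[OF b(1)] tt by simp
    moreover have "b ^ 3 * (t - \<tau>) ^ 4 > 0" using b tt by simp
    ultimately show ?thesis using pos by (simp add: n_def t_def zero_less_divide_iff zero_less_mult_iff)
  qed
  ultimately show False using le by simp
qed

text \<open>The right-hand side extends continuously by zero to \<open>t = \<tau>\<close> when its
  exponent is positive, so extrema can be sought on a compact cap.\<close>

lemma exp_barrier:
  assumes "\<tau> < t"
  shows "exp (barrier b \<kappa> \<tau> t) = (t - \<tau>) powr ((1 + \<kappa>) / b) * exp (- 2 * \<kappa> * t / b)"
  using assms by (simp add: barrier_def powr_def diff_divide_distrib exp_diff exp_minus field_simps)

lemma compact_closed_hemisphere: "compact (closed_hemisphere e)"
proof -
  have "closed_hemisphere e = sphere 0 1 \<inter> {y. 0 \<le> e \<bullet> y}"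
    by (auto simp: closed_hemisphere_def inner_commute)
  then show ?thesis by (simp add: compact_Int_closed closed_halfspace_ge)
qed

lemma spherical_p_harmonic_continuous:
  fixes \<psi> :: "'a::euclidean_space \<Rightarrow> real"
  assumes "spherical_p_harmonic e p \<beta> \<psi>"
  shows "continuous_on (closed_hemisphere e) \<psi>"
proof -
  obtain U g where U: "closed_hemisphere e \<subseteq> U" "C2_on_open U g"
    and g: "\<And>y. y \<in> closed_hemisphere e \<Longrightarrow> g y = \<psi> y"
    using assms unfolding spherical_p_harmonic_def C2_on_closed_hemisphere_def by blast
  then have "continuous_on U g"
    unfolding C2_on_open_def by (meson continuous_at_imp_continuous_on has_derivative_continuous)
  then show ?thesis using U(1) g continuous_on_subset continuous_on_cong by metis
qed

text \<open>The quotient of \<open>exp h\<close> and \<open>\<psi> powr (1 / \<beta>)\<close> is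
  continuous on the compact cap, positive at the pole and zero on the rim. Its maximum is therefore
  a contact point above height \<tau>.\<close>

lemma barrier_from_below:
  fixes \<psi> :: "'a::euclidean_space \<Rightarrow> real"
  assumes sol: "spherical_p_harmonic e p \<beta> \<psi>" and \<beta>: "\<beta> > 0" and p: "p > 1" and e: "norm e = 1"
    and \<kappa>: "\<kappa> > -1" and \<tau>: "0 < \<tau>" "\<tau> < 1" and b: "b > 0" "b \<le> \<beta>"
    and pos: "\<And>t. 0 \<le> t \<Longrightarrow> t \<le> 1 \<Longrightarrow> barrier_poly (real DIM('a)) p b \<kappa> \<tau> t > 0"
  shows False
proof -
  define K where "K = closed_hemisphere e \<inter> {y. \<tau> \<le> e \<bullet> y}"
  define w where "w = (\<lambda>t. (t - \<tau>) powr ((1 + \<kappa>) / b) * exp (- 2 * \<kappa> * t / b))"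
  define R where "R = (\<lambda>y. w (y \<bullet> e) / \<psi> y powr (1 / \<beta>))"
  have cK: "compact K"
    unfolding K_def using compact_closed_hemisphere closed_halfspace_ge by (rule compact_Int_closed)
  have KU: "y \<in> upper_hemisphere e" if "y \<in> K" for y
    using that \<tau> by (auto simp: K_def upper_hemisphere_def closed_hemisphere_def inner_commute)
  have \<psi>pos: "\<psi> y > 0" if "y \<in> upper_hemisphere e" for y
    using sol that unfolding spherical_p_harmonic_def by blast
  have eK: "e \<in> K" using e \<tau> by (auto simp: K_def closed_hemisphere_def norm_eq_1)
  have "continuous_on K \<psi>"
    by (rule continuous_on_subset[OF spherical_p_harmonic_continuous[OF sol]]) (simp add: K_def)
  then have den: "continuous_on K (\<lambda>y. \<psi> y powr (1 / \<beta>))"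
    using \<psi>pos[OF KU] by (intro continuous_on_powr continuous_on_const) fastforce+
  have "continuous_on K (\<lambda>y. (y \<bullet> e - \<tau>) powr ((1 + \<kappa>) / b))"
    by (rule continuous_on_powr') (use \<kappa> b in \<open>auto intro!: continuous_intros simp: K_def inner_commute\<close>)
  then have num: "continuous_on K (\<lambda>y. w (y \<bullet> e))"
    unfolding w_def by (rule continuous_on_mult) (use b(1) in \<open>auto intro!: continuous_intros\<close>)
  have "continuous_on K R"
    unfolding R_def by (rule continuous_on_divide[OF num den]) (use \<psi>pos[OF KU] in fastforce)
  then obtain \<sigma> where \<sigma>: "\<sigma> \<in> K" "\<And>y. y \<in> K \<Longrightarrow> R y \<le> R \<sigma>"
    using continuous_attains_sup[OF cK] eK by blast
  have "R e > 0"
    unfolding R_def w_def using \<psi>pos[OF KU[OF eK]] \<tau> e by (simp add: norm_eq_1)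
  then have "R \<sigma> > 0" using \<sigma>(2)[OF eK] by linarith
  \<comment> \<open>Zero to any power is zero for \<open>powr\<close>, so \<open>R\<close> vanishes
    at height \<tau>.\<close>
  then have "\<sigma> \<bullet> e \<noteq> \<tau>" by (auto simp: R_def w_def)
  then have \<tau>\<sigma>: "\<tau> < \<sigma> \<bullet> e" using \<sigma>(1) by (simp add: K_def inner_commute)
  have R: "R y = exp (barrier b \<kappa> \<tau> (y \<bullet> e) - ln (\<psi> y) / \<beta>)" if "y \<in> upper_hemisphere e" "\<tau> < y \<bullet> e" for y
    unfolding R_def w_def exp_barrier[OF that(2), symmetric] using \<psi>pos[OF that(1)]
    by (simp add: powr_def exp_diff)
  have "\<sigma> \<bullet> e \<le> 1"
    using \<sigma>(1) norm_cauchy_schwarz[of \<sigma> e] e by (simp add: K_def closed_hemisphere_def)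
  show False
  proof (rule barrier_no_contact[OF sol \<beta> p e KU[OF \<sigma>(1)], of 1 b \<tau> \<kappa>])
    fix y assume y: "y \<in> upper_hemisphere e" "\<tau> < y \<bullet> e"
    then have "y \<in> K" by (auto simp: K_def upper_hemisphere_def closed_hemisphere_def inner_commute)
    from \<sigma>(2)[OF this] show "1 * (barrier b \<kappa> \<tau> (y \<bullet> e) - ln (\<psi> y) / \<beta>) \<le> 1 * (barrier b \<kappa> \<tau> (\<sigma> \<bullet> e) - ln (\<psi> \<sigma>) / \<beta>)"
      unfolding R[OF y] R[OF KU[OF \<sigma>(1)] \<tau>\<sigma>] by simp
  qed (use b \<tau>\<sigma> \<tau> pos[of "\<sigma> \<bullet> e"] \<open>\<sigma> \<bullet> e \<le> 1\<close> in auto)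
qed

text \<open>The roles are exchanged: \<tau> < 0 keeps \<open>exp h\<close> positive on the closed
  hemisphere, while \<open>\<psi> powr (1 / \<beta>)\<close> vanishes on the equator. The maximum of
  their quotient lies in the open hemisphere and is a contact with \<epsilon> = -1.\<close>

lemma barrier_from_above:
  fixes \<psi> :: "'a::euclidean_space \<Rightarrow> real"
  assumes sol: "spherical_p_harmonic e p \<beta> \<psi>" and \<beta>: "\<beta> > 0" and p: "p > 1" and e: "norm e = 1"
    and \<tau>: "\<tau> < 0" and b: "b > 0" "\<beta> \<le> b"
    and neg: "\<And>t. 0 \<le> t \<Longrightarrow> t \<le> 1 \<Longrightarrow> barrier_poly (real DIM('a)) p b \<kappa> \<tau> t < 0"
  shows False
proof -
  define R where "R = (\<lambda>y. \<psi> y powr (1 / \<beta>) / exp (barrier b \<kappa> \<tau> (y \<bullet> e)))"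
  let ?K = "closed_hemisphere e"
  have KU: "y \<in> upper_hemisphere e \<or> y \<in> equator e" if "y \<in> ?K" for y
    using that by (auto simp: upper_hemisphere_def closed_hemisphere_def equator_def)
  have \<psi>pos: "\<psi> y > 0" if "y \<in> upper_hemisphere e" for y
    using sol that unfolding spherical_p_harmonic_def by blast
  have \<psi>0: "\<psi> y = 0" if "y \<in> equator e" for y
    using sol that unfolding spherical_p_harmonic_def by blast
  have nonneg: "\<psi> y \<ge> 0" if "y \<in> ?K" for y
    using KU[OF that] \<psi>pos \<psi>0 by (metis less_eq_real_def order_refl)
  have eU: "e \<in> upper_hemisphere e" and eK: "e \<in> ?K"
    using e by (auto simp: upper_hemisphere_def closed_hemisphere_def norm_eq_1)
  have num: "continuous_on ?K (\<lambda>y. \<psi> y powr (1 / \<beta>))"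
    by (rule continuous_on_powr') (use \<beta> nonneg spherical_p_harmonic_continuous[OF sol] in auto)
  have "y \<bullet> e - \<tau> \<noteq> 0" if "y \<in> ?K" for y using that \<tau> by (auto simp: closed_hemisphere_def)
  then have den: "continuous_on ?K (\<lambda>y. exp (barrier b \<kappa> \<tau> (y \<bullet> e)))"
    unfolding barrier_def using b(1) by (intro continuous_intros) auto
  have "continuous_on ?K R"
    unfolding R_def by (rule continuous_on_divide[OF num den]) simp
  then obtain \<sigma> where \<sigma>: "\<sigma> \<in> ?K" "\<And>y. y \<in> ?K \<Longrightarrow> R y \<le> R \<sigma>"
    using continuous_attains_sup[OF compact_closed_hemisphere] eK by blast
  have "R e > 0" unfolding R_def using \<psi>pos[OF eU] by simp
  then have "R \<sigma> > 0" using \<sigma>(2)[OF eK] by linarith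
  then have "\<psi> \<sigma> \<noteq> 0" by (auto simp: R_def)
  then have \<sigma>U: "\<sigma> \<in> upper_hemisphere e" using KU[OF \<sigma>(1)] \<psi>0 by blast
  then have \<sigma>e: "\<sigma> \<bullet> e > 0" by (simp add: upper_hemisphere_def)
  have R: "R y = exp (- (barrier b \<kappa> \<tau> (y \<bullet> e) - ln (\<psi> y) / \<beta>))" if "y \<in> upper_hemisphere e" for y
    unfolding R_def using \<psi>pos[OF that] by (simp add: powr_def exp_diff)
  have "\<sigma> \<bullet> e \<le> 1"
    using \<sigma>(1) norm_cauchy_schwarz[of \<sigma> e] e by (simp add: closed_hemisphere_def)
  show False
  proof (rule barrier_no_contact[OF sol \<beta> p e \<sigma>U, of "-1" b \<tau> \<kappa>])
    fix y assume y: "y \<in> upper_hemisphere e"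
    then have "y \<in> ?K" by (auto simp: upper_hemisphere_def closed_hemisphere_def)
    from \<sigma>(2)[OF this]
    show "- 1 * (barrier b \<kappa> \<tau> (y \<bullet> e) - ln (\<psi> y) / \<beta>) \<le> - 1 * (barrier b \<kappa> \<tau> (\<sigma> \<bullet> e) - ln (\<psi> \<sigma>) / \<beta>)"
      unfolding R[OF y] R[OF \<sigma>U] by simp
  qed (use b \<sigma>e \<tau> neg[of "\<sigma> \<bullet> e"] \<open>\<sigma> \<bullet> e \<le> 1\<close> in auto)
qed

section \<open>Comparison of the exponent with its critical value\<close>

theorem theoremA:
  fixes e :: "'a::euclidean_space" and p \<beta> :: real
  assumes "e \<in> Basis"
    and "DIM('a) \<ge> 2"
    and "1 < p" and "p \<le> real DIM('a)"
    and "is_spherical_exponent e p \<beta>"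
  shows "(2 \<le> p \<longrightarrow>
            \<beta> \<le> (real DIM('a) - 1) / (p - 1) \<and>
            (\<beta> = (real DIM('a) - 1) / (p - 1) \<longrightarrow> p = 2 \<or> p = real DIM('a))) \<and>
         (p < 2 \<longrightarrow> \<beta> > (real DIM('a) - 1) / (p - 1))"
proof -
  define n where "n = real DIM('a)"
  define b where "b = (n - 1) / (p - 1)"
  obtain \<psi> where \<beta>: "\<beta> > 0" and sol: "spherical_p_harmonic e p \<beta> \<psi>"
    using assms(5) by (auto simp: is_spherical_exponent_def)
  have e: "norm e = 1" using assms(1) by simp
  have n: "n \<ge> 2" "p \<le> n" using assms by (auto simp: n_def)
  have bp: "b * (p - 1) = n - 1" using assms(3) by (simp add: b_def)
  have "p \<ge> 2 \<longrightarrow> \<beta> \<le> b \<and> (\<beta> = b \<longrightarrow> p = 2 \<or> p = n)"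
  proof (intro impI, rule ccontr)
    assume p: "p \<ge> 2" and "\<not> (\<beta> \<le> b \<and> (\<beta> = b \<longrightarrow> p = 2 \<or> p = n))"
    then have \<beta>b: "\<beta> \<ge> b" and strict: "\<beta> > b \<or> 2 < p \<and> p < n" using n by auto
    have b1: "b \<ge> 1" using n assms(3) by (simp add: b_def)
    \<comment> \<open>For \<open>p \<ge> 2\<close> the barrier is built with \<beta> itself.
      \<open>D\<close> is the last factor in \<open>barrier_poly_0\<close>, equal to
      \<open>(\<beta> + 1) * (\<beta> - b) * (p - 1)\<close>.\<close>
    define D where "D = \<beta> * (\<beta> * (p - 1) + p - n) - (n - 1)"
    have \<beta>p: "\<beta> * (p - 1) - (n - 1) = (\<beta> - b) * (p - 1)" using bp by (simp add: algebra_simps)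
    have D: "D = (\<beta> - b) * (p - 1) + \<beta> * ((\<beta> - b) * (p - 1))"
      unfolding \<beta>p[symmetric] D_def by (simp add: algebra_simps)
    have D0: "D \<ge> 0" unfolding D using \<beta>b p \<beta> by simp
    have \<beta>1: "\<beta>\<^sup>2 \<ge> 1" using b1 \<beta>b by (simp add: one_le_power)
    have F: "barrier_poly n p \<beta> 0 0 t = t\<^sup>2 * ((p - 2) * (1 - t\<^sup>2) * (\<beta>\<^sup>2 - 1) + (\<beta>\<^sup>2 * t\<^sup>2 + (1 - t\<^sup>2)) * D)" for t
      unfolding barrier_poly_0 D_def by simp
    have inner: "1 * barrier_poly n p \<beta> 0 0 t > 0" if t: "0 < t" "t < 1" for t
    proof -
      have t2: "1 - t\<^sup>2 > 0" using t by (simp add: power_strict_mono abs_square_less_1)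
      have Q: "\<beta>\<^sup>2 * t\<^sup>2 + (1 - t\<^sup>2) > 0" using t2 by (simp add: add_nonneg_pos)
      have 1: "(p - 2) * (1 - t\<^sup>2) * (\<beta>\<^sup>2 - 1) \<ge> 0" "(\<beta>\<^sup>2 * t\<^sup>2 + (1 - t\<^sup>2)) * D \<ge> 0"
        using p t2 \<beta>1 Q D0 by simp_all
      \<comment> \<open>If \<beta> exceeds \<open>b\<close>, the term with \<open>D\<close> is
        positive. If only \<open>2 < p < n\<close> is known, then \<open>b > 1\<close> and the other
        term is positive.\<close>
      from strict have "(p - 2) * (1 - t\<^sup>2) * (\<beta>\<^sup>2 - 1) > 0 \<or> (\<beta>\<^sup>2 * t\<^sup>2 + (1 - t\<^sup>2)) * D > 0"
      proof
        assume "\<beta> > b"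
        then have "D > 0" unfolding D using p \<beta> by (simp add: add_pos_pos)
        then show ?thesis using Q by simp
      next
        assume pn: "2 < p \<and> p < n"
        then have "b > 1" using assms(3) by (simp add: b_def)
        then have "\<beta>\<^sup>2 > 1" using \<beta>b by (simp add: one_less_power)
        then show ?thesis using pn t2 by simp
      qed
      then show ?thesis unfolding F using 1 t by (auto intro: add_pos_nonneg add_nonneg_pos)
    qed
    \<comment> \<open>At the pole only the term with \<open>D\<close> survives; it is zero when
      \<beta> = \<open>b\<close>.\<close>
    have pole: "1 * barrier_poly n p \<beta> 0 0 1 \<ge> 0" unfolding F using D0 by simp
    obtain k \<tau> where "0 < k" "k < 1" "0 < \<tau>" "\<tau> < 1"
      "\<And>t. 0 \<le> t \<Longrightarrow> t \<le> 1 \<Longrightarrow> 1 * barrier_poly n p \<beta> (1 * k) (1 * \<tau>) t > 0"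
      using barrier_exists[of n p \<beta> 1] n assms(3) \<beta> inner pole by auto
    then show False
      using barrier_from_below[OF sol \<beta> assms(3) e, of k \<tau> \<beta>] \<beta> by (auto simp: n_def)
  qed
  moreover have "p < 2 \<longrightarrow> \<beta> > b"
  proof (intro impI, rule ccontr)
    assume p: "p < 2" and "\<not> \<beta> > b"
    then have \<beta>b: "\<beta> \<le> b" by simp
    have b1: "b > 1" using n p assms(3) by (simp add: b_def)
    then have b2: "b\<^sup>2 > 1" by (simp add: one_less_power)
    have "b * (p - 1) + p - n = p - 1" using bp by simp
    then have "b * (b * (p - 1) + p - n) - (n - 1) = 0" using bp by simp
    then have F: "barrier_poly n p b 0 0 t = t\<^sup>2 * ((p - 2) * (1 - t\<^sup>2) * (b\<^sup>2 - 1))" for t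
      unfolding barrier_poly_0 by simp
    have inner: "- 1 * barrier_poly n p b 0 0 t > 0" if t: "0 < t" "t < 1" for t
    proof -
      have "1 - t\<^sup>2 > 0" using t by (simp add: power_strict_mono abs_square_less_1)
      then have "(2 - p) * (1 - t\<^sup>2) * (b\<^sup>2 - 1) > 0" using p b2 by simp
      then have "t\<^sup>2 * ((2 - p) * (1 - t\<^sup>2) * (b\<^sup>2 - 1)) > 0" using t by simp
      then show ?thesis unfolding F by (simp add: algebra_simps)
    qed
    obtain k \<tau> where k: "0 < k" "k < 1" "0 < \<tau>" "\<tau> < 1"
      "\<And>t. 0 \<le> t \<Longrightarrow> t \<le> 1 \<Longrightarrow> - 1 * barrier_poly n p b (- 1 * k) (- 1 * \<tau>) t > 0"
      using barrier_exists[of n p b "-1"] n assms(3) b1 inner F[of 1] by auto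
    show False
      by (rule barrier_from_above[OF sol \<beta> assms(3) e, of "- \<tau>" b "- k"])
        (use k \<beta>b b1 in \<open>auto simp: n_def\<close>)
  qed
  ultimately show ?thesis unfolding b_def n_def by blast
qed

end
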